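(* Let $H$ be a Hopf algebra over a field $k$. (i) Given a coalgebra $C$ and a partial corepresentation $\omega:C\to H$, there exists a unique coalgebra map $\bar\omega:C\to H^{par}$ such that $\omega=p\circ\bar\omega$. (ii) $H$ is a subcoalgebra and a $k$-linear direct summand of $H^{par}$.
   Context: A partial corepresentation of $H$ (antipode $S$) over a coalgebra $C$ is a linear map $\omega:C\to H$ with, for all $c\in C$: $\epsilon_H(\omega(c))=\epsilon_C(c)$; $\omega(c_{(1)})_{(1)}\otimes\omega(c_{(1)})_{(2)}S(\omega(c_{(2)}))=\omega(c_{(1)})\otimes\omega(c_{(2)})S(\omega(c_{(3)}))$; $\omega(c_{(1)})S(\omega(c_{(2)})_{(1)})\otimes\omega(c_{(2)})_{(2)}=\omega(c_{(1)})S(\omega(c_{(2)}))\otimes\omega(c_{(3)})$. $(C(H),p)$, $p:C(H)\to H$, is the cofree coalgebra over the vector space $H$: for any coalgebra $D$ and linear map $f:D\to H$ there is a unique coalgebra map $\overline f:D\to C(H)$ with $p\circ\overline f=f$. $H^{par}$ is the sum of all subcoalgebras $X\subseteq C(H)$ such that $p|_X$ is a partial corepresentation; it is the largest subcoalgebra of $C(H)$ with this property. The restriction of $p$ to $H^{par}$ is again denoted $p$. In (ii), $H$ is viewed inside $H^{par}$ through the coalgebra map $\imath:H\to H^{par}$ with $p\circ\imath=\mathrm{Id}_H$ obtained by applying (i) to the partial corepresentation $\mathrm{Id}_H$. *)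

theory Defs
  imports "HOL-Algebra.AbelCoset" "HOL-Algebra.Module"
begin

section \<open>Linear maps and spans\<close>

text \<open>A vector space over a field \<open>K\<close> is a \<^locale>\<open>module\<close> over \<open>K\<close>.\<close>

definition linear_maps ::
  "('k, 'p) ring_scheme \<Rightarrow> ('k, 'v, 'm) module_scheme \<Rightarrow> ('k, 'w, 'n) module_scheme \<Rightarrow> ('v \<Rightarrow> 'w) set"
  where "linear_maps K V W = {f \<in> carrier V \<rightarrow> carrier W.
    (\<forall>x\<in>carrier V. \<forall>y\<in>carrier V. f (x \<oplus>\<^bsub>V\<^esub> y) = f x \<oplus>\<^bsub>W\<^esub> f y) \<and>
    (\<forall>a\<in>carrier K. \<forall>x\<in>carrier V. f (a \<odot>\<^bsub>V\<^esub> x) = a \<odot>\<^bsub>W\<^esub> f x)}"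

definition module_span ::
  "('k, 'p) ring_scheme \<Rightarrow> ('k, 'v, 'm) module_scheme \<Rightarrow> 'v set \<Rightarrow> 'v set"
  where "module_span K V A = \<Inter>{N. submodule N K V \<and> A \<subseteq> N}"

definition scalars :: "('k, 'p) ring_scheme \<Rightarrow> ('k, 'k) module"
  where "scalars K = \<lparr>carrier = carrier K, monoid.mult = mult K, one = one K,
    zero = zero K, add = add K, smult = mult K\<rparr>"

definition direct_summand ::
  "('k, 'p) ring_scheme \<Rightarrow> 'v set \<Rightarrow> ('k, 'v, 'm) module_scheme \<Rightarrow> bool"
  where "direct_summand K X V \<longleftrightarrow> submodule X K V \<and>
    (\<exists>W. submodule W K V \<and> X <+>\<^bsub>V\<^esub> W = carrier V \<and> X \<inter> W = {\<zero>\<^bsub>V\<^esub>})"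


section \<open>Tensor products\<close>

text \<open>The tensor product is the quotient of the free \<open>K\<close>-module on \<open>carrier V \<times> carrier W\<close> by the
  submodule generated by the bilinearity relations; its elements are cosets.  The
  multiplicative record fields of \<^typ>\<open>('a, 'b) module\<close> play no role for a mere module and are
  left unspecified.\<close>

definition free_module :: "('k, 'p) ring_scheme \<Rightarrow> 'x set \<Rightarrow> ('k, 'x \<Rightarrow> 'k) module"
  where "free_module K X = \<lparr>
    carrier = {f. (\<forall>x\<in>X. f x \<in> carrier K) \<and> (\<forall>x. x \<notin> X \<longrightarrow> f x = \<zero>\<^bsub>K\<^esub>) \<and> finite {x. f x \<noteq> \<zero>\<^bsub>K\<^esub>}},
    monoid.mult = undefined, one = undefined,
    zero = (\<lambda>_. \<zero>\<^bsub>K\<^esub>),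
    add = (\<lambda>f g x. f x \<oplus>\<^bsub>K\<^esub> g x),
    smult = (\<lambda>a f x. a \<otimes>\<^bsub>K\<^esub> f x)\<rparr>"

definition quotient_module :: "('k, 'v, 'm) module_scheme \<Rightarrow> 'v set \<Rightarrow> ('k, 'v set) module"
  where "quotient_module V N = \<lparr>
    carrier = a_rcosets\<^bsub>V\<^esub> N,
    monoid.mult = undefined, one = undefined,
    zero = N,
    add = (\<lambda>A B. A <+>\<^bsub>V\<^esub> B),
    smult = (\<lambda>a A. \<Union>x\<in>A. N +>\<^bsub>V\<^esub> (a \<odot>\<^bsub>V\<^esub> x))\<rparr>"

definition basis_vec :: "('k, 'p) ring_scheme \<Rightarrow> 'x \<Rightarrow> 'x \<Rightarrow> 'k"
  where "basis_vec K x = (\<lambda>y. if y = x then \<one>\<^bsub>K\<^esub> else \<zero>\<^bsub>K\<^esub>)"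

definition bilinear_rels ::
  "('k, 'p) ring_scheme \<Rightarrow> ('k, 'v, 'm) module_scheme \<Rightarrow> ('k, 'w, 'n) module_scheme
    \<Rightarrow> ('v \<times> 'w \<Rightarrow> 'k) set"
  where "bilinear_rels K V W = (let F = free_module K (carrier V \<times> carrier W); e = basis_vec K in
      {e (v \<oplus>\<^bsub>V\<^esub> v', w) \<ominus>\<^bsub>F\<^esub> (e (v, w) \<oplus>\<^bsub>F\<^esub> e (v', w)) | v v' w.
         v \<in> carrier V \<and> v' \<in> carrier V \<and> w \<in> carrier W}
    \<union> {e (v, w \<oplus>\<^bsub>W\<^esub> w') \<ominus>\<^bsub>F\<^esub> (e (v, w) \<oplus>\<^bsub>F\<^esub> e (v, w')) | v w w'.
         v \<in> carrier V \<and> w \<in> carrier W \<and> w' \<in> carrier W}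
    \<union> {e (a \<odot>\<^bsub>V\<^esub> v, w) \<ominus>\<^bsub>F\<^esub> (a \<odot>\<^bsub>F\<^esub> e (v, w)) | a v w.
         a \<in> carrier K \<and> v \<in> carrier V \<and> w \<in> carrier W}
    \<union> {e (v, a \<odot>\<^bsub>W\<^esub> w) \<ominus>\<^bsub>F\<^esub> (a \<odot>\<^bsub>F\<^esub> e (v, w)) | a v w.
         a \<in> carrier K \<and> v \<in> carrier V \<and> w \<in> carrier W})"

definition tensor_null ::
  "('k, 'p) ring_scheme \<Rightarrow> ('k, 'v, 'm) module_scheme \<Rightarrow> ('k, 'w, 'n) module_scheme
    \<Rightarrow> ('v \<times> 'w \<Rightarrow> 'k) set"
  where "tensor_null K V W =
    module_span K (free_module K (carrier V \<times> carrier W)) (bilinear_rels K V W)"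

definition tensor ::
  "('k, 'p) ring_scheme \<Rightarrow> ('k, 'v, 'm) module_scheme \<Rightarrow> ('k, 'w, 'n) module_scheme
    \<Rightarrow> ('k, ('v \<times> 'w \<Rightarrow> 'k) set) module"
  where "tensor K V W =
    quotient_module (free_module K (carrier V \<times> carrier W)) (tensor_null K V W)"

definition tpure ::
  "('k, 'p) ring_scheme \<Rightarrow> ('k, 'v, 'm) module_scheme \<Rightarrow> ('k, 'w, 'n) module_scheme
    \<Rightarrow> 'v \<Rightarrow> 'w \<Rightarrow> ('v \<times> 'w \<Rightarrow> 'k) set"
  where "tpure K V W v w =
    tensor_null K V W +>\<^bsub>free_module K (carrier V \<times> carrier W)\<^esub> basis_vec K (v, w)"

text \<open>\<open>tlift K U b\<close> is the linear map \<open>V \<otimes> W \<rightarrow> U\<close> with \<open>v \<otimes> w \<mapsto> b v w\<close>, for a bilinear \<open>b\<close>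
  (for which the choice of representative is irrelevant).  It renders Sweedler notation:
  the term written \<open>b c\<^sub>1 c\<^sub>2\<close> is \<open>tlift K U b (comult C c)\<close>, and three-fold indices are
  obtained by nesting.\<close>

definition tlift ::
  "('k, 'p) ring_scheme \<Rightarrow> ('k, 'u, 'm) module_scheme \<Rightarrow> ('v \<Rightarrow> 'w \<Rightarrow> 'u) \<Rightarrow> ('v \<times> 'w \<Rightarrow> 'k) set \<Rightarrow> 'u"
  where "tlift K U b T = (let t = (SOME t. t \<in> T) in
    \<Oplus>\<^bsub>U\<^esub>z \<in> {z. t z \<noteq> \<zero>\<^bsub>K\<^esub>}. t z \<odot>\<^bsub>U\<^esub> b (fst z) (snd z))"

text \<open>The map \<open>f \<otimes> g\<close> with values in \<open>V \<otimes> W\<close>.\<close>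

definition tmap ::
  "('k, 'p) ring_scheme \<Rightarrow> ('k, 'v, 'm) module_scheme \<Rightarrow> ('k, 'w, 'n) module_scheme
    \<Rightarrow> ('a \<Rightarrow> 'v) \<Rightarrow> ('b \<Rightarrow> 'w) \<Rightarrow> ('a \<times> 'b \<Rightarrow> 'k) set \<Rightarrow> ('v \<times> 'w \<Rightarrow> 'k) set"
  where "tmap K V W f g = tlift K (tensor K V W) (\<lambda>x y. tpure K V W (f x) (g y))"


section \<open>Coalgebras and Hopf algebras\<close>

record ('k, 'c) coalgebra = "('k, 'c) module" +
  comult :: "'c \<Rightarrow> ('c \<times> 'c \<Rightarrow> 'k) set"
  counit :: "'c \<Rightarrow> 'k"

text \<open>Coassociativity is stated in \<open>C \<otimes> (C \<otimes> C)\<close>.\<close>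

locale coalgebra = K?: field K + module K C
  for K :: "('k, 'p) ring_scheme" and C :: "('k, 'c) coalgebra" +
  assumes comult_linear: "comult C \<in> linear_maps K C (tensor K C C)"
    and counit_linear: "counit C \<in> linear_maps K C (scalars K)"
    and coassoc: "c \<in> carrier C \<Longrightarrow>
      tlift K (tensor K C (tensor K C C))
        (\<lambda>c' z. tlift K (tensor K C (tensor K C C))
          (\<lambda>x y. tpure K C (tensor K C C) x (tpure K C C y z)) (comult C c')) (comult C c)
      = tlift K (tensor K C (tensor K C C))
          (\<lambda>x c'. tpure K C (tensor K C C) x (comult C c')) (comult C c)"
    and counit_left: "c \<in> carrier C \<Longrightarrow>
      tlift K C (\<lambda>x y. counit C x \<odot>\<^bsub>C\<^esub> y) (comult C c) = c"
    and counit_right: "c \<in> carrier C \<Longrightarrow>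
      tlift K C (\<lambda>x y. counit C y \<odot>\<^bsub>C\<^esub> x) (comult C c) = c"

definition coalg_hom ::
  "('k, 'p) ring_scheme \<Rightarrow> ('k, 'c) coalgebra \<Rightarrow> ('k, 'd) coalgebra \<Rightarrow> ('c \<Rightarrow> 'd) set"
  where "coalg_hom K C D = {f \<in> linear_maps K C D. \<forall>c\<in>carrier C.
    comult D (f c) = tmap K D D f f (comult C c) \<and> counit D (f c) = counit C c}"

text \<open>A subspace \<open>X\<close> with \<open>\<Delta>(X) \<subseteq> X \<otimes> X\<close>, where \<open>X \<otimes> X\<close> is viewed in \<open>C \<otimes> C\<close> through the map
  induced by the inclusion.\<close>

definition subcoalgebra :: "('k, 'p) ring_scheme \<Rightarrow> 'c set \<Rightarrow> ('k, 'c) coalgebra \<Rightarrow> bool"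
  where "subcoalgebra K X C \<longleftrightarrow> submodule X K C \<and>
    (\<forall>x\<in>X. comult C x \<in> tmap K C C (\<lambda>x. x) (\<lambda>x. x) `
       carrier (tensor K (C\<lparr>carrier := X\<rparr>) (C\<lparr>carrier := X\<rparr>)))"

text \<open>A subcoalgebra as a coalgebra in its own right.  Its comultiplication takes values in
  the tensor square of \<open>X\<close> itself, hence is pulled back along the map \<open>X \<otimes> X \<rightarrow> C \<otimes> C\<close>, which is
  injective over a field.\<close>

definition sub_coalg :: "('k, 'p) ring_scheme \<Rightarrow> ('k, 'c) coalgebra \<Rightarrow> 'c set \<Rightarrow> ('k, 'c) coalgebra"
  where "sub_coalg K C X = C\<lparr>carrier := X,
    comult := (\<lambda>x. THE t. t \<in> carrier (tensor K (C\<lparr>carrier := X\<rparr>) (C\<lparr>carrier := X\<rparr>)) \<and>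
      tmap K C C (\<lambda>x. x) (\<lambda>x. x) t = comult C x)\<rparr>"

text \<open>A Hopf algebra \<open>H\<close> with antipode \<open>S\<close>; the algebra structure is given by the
  multiplicative fields of the record \<open>H\<close>.\<close>

locale hopf_algebra = coalgebra K H + H?: ring H
  for K :: "('k, 'p) ring_scheme" and H :: "('k, 'h) coalgebra" +
  fixes S :: "'h \<Rightarrow> 'h"
  assumes smult_mult_left: "\<lbrakk>a \<in> carrier K; x \<in> carrier H; y \<in> carrier H\<rbrakk> \<Longrightarrow>
      (a \<odot>\<^bsub>H\<^esub> x) \<otimes>\<^bsub>H\<^esub> y = a \<odot>\<^bsub>H\<^esub> (x \<otimes>\<^bsub>H\<^esub> y)"
    and smult_mult_right: "\<lbrakk>a \<in> carrier K; x \<in> carrier H; y \<in> carrier H\<rbrakk> \<Longrightarrow>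
      x \<otimes>\<^bsub>H\<^esub> (a \<odot>\<^bsub>H\<^esub> y) = a \<odot>\<^bsub>H\<^esub> (x \<otimes>\<^bsub>H\<^esub> y)"
    and comult_mult: "\<lbrakk>x \<in> carrier H; y \<in> carrier H\<rbrakk> \<Longrightarrow>
      comult H (x \<otimes>\<^bsub>H\<^esub> y) =
        tlift K (tensor K H H) (\<lambda>x\<^sub>1 x\<^sub>2. tlift K (tensor K H H)
          (\<lambda>y\<^sub>1 y\<^sub>2. tpure K H H (x\<^sub>1 \<otimes>\<^bsub>H\<^esub> y\<^sub>1) (x\<^sub>2 \<otimes>\<^bsub>H\<^esub> y\<^sub>2)) (comult H y)) (comult H x)"
    and comult_one: "comult H \<one>\<^bsub>H\<^esub> = tpure K H H \<one>\<^bsub>H\<^esub> \<one>\<^bsub>H\<^esub>"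
    and counit_mult: "\<lbrakk>x \<in> carrier H; y \<in> carrier H\<rbrakk> \<Longrightarrow>
      counit H (x \<otimes>\<^bsub>H\<^esub> y) = counit H x \<otimes>\<^bsub>K\<^esub> counit H y"
    and counit_one: "counit H \<one>\<^bsub>H\<^esub> = \<one>\<^bsub>K\<^esub>"
    and antipode_linear: "S \<in> linear_maps K H H"
    and antipode_left: "h \<in> carrier H \<Longrightarrow>
      tlift K H (\<lambda>x y. S x \<otimes>\<^bsub>H\<^esub> y) (comult H h) = counit H h \<odot>\<^bsub>H\<^esub> \<one>\<^bsub>H\<^esub>"
    and antipode_right: "h \<in> carrier H \<Longrightarrow>
      tlift K H (\<lambda>x y. x \<otimes>\<^bsub>H\<^esub> S y) (comult H h) = counit H h \<odot>\<^bsub>H\<^esub> \<one>\<^bsub>H\<^esub>"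


section \<open>Partial corepresentations, cofree coalgebras and the universal coalgebra\<close>

text \<open>Here \<open>C\<close> is understood to be a coalgebra.  The last two conjuncts read, in Sweedler notation,
  \<open>\<omega>(c\<^sub>1)\<^sub>1 \<otimes> \<omega>(c\<^sub>1)\<^sub>2 S(\<omega>(c\<^sub>2)) = \<omega>(c\<^sub>1) \<otimes> \<omega>(c\<^sub>2) S(\<omega>(c\<^sub>3))\<close> and
  \<open>\<omega>(c\<^sub>1) S(\<omega>(c\<^sub>2)\<^sub>1) \<otimes> \<omega>(c\<^sub>2)\<^sub>2 = \<omega>(c\<^sub>1) S(\<omega>(c\<^sub>2)) \<otimes> \<omega>(c\<^sub>3)\<close>.\<close>

definition partial_corep ::
  "('k, 'p) ring_scheme \<Rightarrow> ('k, 'h) coalgebra \<Rightarrow> ('h \<Rightarrow> 'h) \<Rightarrow> ('k, 'c) coalgebra \<Rightarrow> ('c \<Rightarrow> 'h) \<Rightarrow> bool"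
  where "partial_corep K H S C \<omega> \<longleftrightarrow> \<omega> \<in> linear_maps K C H \<and> (\<forall>c\<in>carrier C.
    counit H (\<omega> c) = counit C c \<and>
    tlift K (tensor K H H)
      (\<lambda>c\<^sub>1 c\<^sub>2. tlift K (tensor K H H)
        (\<lambda>x y. tpure K H H x (y \<otimes>\<^bsub>H\<^esub> S (\<omega> c\<^sub>2))) (comult H (\<omega> c\<^sub>1))) (comult C c)
    = tlift K (tensor K H H)
      (\<lambda>c' c\<^sub>3. tlift K (tensor K H H)
        (\<lambda>c\<^sub>1 c\<^sub>2. tpure K H H (\<omega> c\<^sub>1) (\<omega> c\<^sub>2 \<otimes>\<^bsub>H\<^esub> S (\<omega> c\<^sub>3))) (comult C c')) (comult C c) \<and>
    tlift K (tensor K H H)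
      (\<lambda>c\<^sub>1 c\<^sub>2. tlift K (tensor K H H)
        (\<lambda>x y. tpure K H H (\<omega> c\<^sub>1 \<otimes>\<^bsub>H\<^esub> S x) y) (comult H (\<omega> c\<^sub>2))) (comult C c)
    = tlift K (tensor K H H)
      (\<lambda>c' c\<^sub>3. tlift K (tensor K H H)
        (\<lambda>c\<^sub>1 c\<^sub>2. tpure K H H (\<omega> c\<^sub>1 \<otimes>\<^bsub>H\<^esub> S (\<omega> c\<^sub>2)) (\<omega> c\<^sub>3)) (comult C c')) (comult C c))"

text \<open>\<open>factors K p C D \<omega> f\<close>: \<open>f : C \<rightarrow> D\<close> is a coalgebra map with \<open>p \<circ> f = \<omega>\<close>.
  Maps are total functions of which only the values on the carrier matter; requiring \<^const>\<open>extensional\<close> makes them literally unique.\<close>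

definition factors ::
  "('k, 'p) ring_scheme \<Rightarrow> ('d \<Rightarrow> 'v) \<Rightarrow> ('k, 'c) coalgebra \<Rightarrow> ('k, 'd) coalgebra
    \<Rightarrow> ('c \<Rightarrow> 'v) \<Rightarrow> ('c \<Rightarrow> 'd) \<Rightarrow> bool"
  where "factors K p C D \<omega> f \<longleftrightarrow> f \<in> coalg_hom K C D \<and> f \<in> extensional (carrier C) \<and>
    (\<forall>c\<in>carrier C. p (f c) = \<omega> c)"

text \<open>\<open>(Q, p)\<close> is cofree over the vector space \<open>V\<close>.  HOL cannot quantify over types inside a
  formula, so the universal property is relative to a type \<open>'d\<close>: it speaks about all
  coalgebras whose carrier is any subset of \<open>'d\<close>.\<close>

definition cofree_coalgebra ::
  "'d itself \<Rightarrow> ('k, 'p) ring_scheme \<Rightarrow> ('k, 'v, 'm) module_scheme \<Rightarrow> ('k, 'q) coalgebra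
    \<Rightarrow> ('q \<Rightarrow> 'v) \<Rightarrow> bool"
  where "cofree_coalgebra T K V Q p \<longleftrightarrow> coalgebra K Q \<and> p \<in> linear_maps K Q V \<and>
    (\<forall>(D :: ('k, 'd) coalgebra) f. coalgebra K D \<and> f \<in> linear_maps K D V \<longrightarrow>
      (\<exists>!g. factors K p D Q f g))"

text \<open>The coalgebra \<open>H\<^sup>p\<^sup>a\<^sup>r\<close> inside the cofree coalgebra \<open>(Q, p)\<close> over \<open>H\<close>: a sum of subspaces
  is the span of their union.\<close>

definition par_coalgebra ::
  "('k, 'p) ring_scheme \<Rightarrow> ('k, 'h) coalgebra \<Rightarrow> ('h \<Rightarrow> 'h) \<Rightarrow> ('k, 'q) coalgebra \<Rightarrow> ('q \<Rightarrow> 'h)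
    \<Rightarrow> ('k, 'q) coalgebra"
  where "par_coalgebra K H S Q p = sub_coalg K Q (module_span K Q
    (\<Union>{X. subcoalgebra K X Q \<and> partial_corep K H S (sub_coalg K Q X) p}))"

end

theory Submission
  imports Defs
begin

text \<open>
  A coalgebra map \<open>g : C \<rightarrow> Q\<close> into the cofree coalgebra with \<open>p \<circ> g = \<omega>\<close> has as image a
  subcoalgebra to which \<open>p\<close> restricts as a partial corepresentation, because the defining
  identities for \<open>\<omega>\<close> are those for \<open>p\<close> pulled back along the surjection \<open>C \<rightarrow> g(C)\<close>; hence
  \<open>g\<close> lands in \<open>H\<^sup>p\<^sup>a\<^sup>r\<close>.  Uniqueness is inherited from \<open>Q\<close>, since \<open>H\<^sup>p\<^sup>a\<^sup>r \<rightarrow> Q\<close> is a coalgebra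
  map.  The identity of \<open>H\<close> is a partial corepresentation by coassociativity, and the kernel
  of \<open>p\<close> is a complement of the image of the section \<open>H \<rightarrow> H\<^sup>p\<^sup>a\<^sup>r\<close>.  That \<open>X \<otimes> X \<rightarrow> Q \<otimes> Q\<close> is
  injective for a subspace \<open>X\<close> follows from a linear retraction of \<open>Q\<close> onto \<open>X\<close>.
\<close>

section \<open>Linear maps\<close>

text \<open>Two encodings shape the work. A tensor is a coset of functions, and \<open>tlift\<close>
  evaluates a Sweedler sum on a representative picked by \<open>SOME\<close>; nothing can be
  computed before the value is known to be independent of that choice, which is shown for bilinear
  integrands. Hence each Sweedler expression, nested ones included, comes with a proof of
  bilinearity, and identities between such expressions are then decided on pure tensors. The
  comultiplication of a subcoalgebra is a \<open>THE\<close>, accessible only through its image in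
  the larger tensor square; injectivity of X \<otimes> X \<rightarrow> Q \<otimes> Q lets equations
  be checked there. This is where the field enters: the retraction comes from a complement found
  with Zorn's lemma. Spans of tensors and sums of subcoalgebras are handled without explicit finite
  sums: the elements with the desired property form a submodule that contains the
  generators.\<close>

lemma linear_mapsI:
  assumes "\<And>x. x \<in> carrier V \<Longrightarrow> f x \<in> carrier W"
    and "\<And>x y. x \<in> carrier V \<Longrightarrow> y \<in> carrier V \<Longrightarrow> f (x \<oplus>\<^bsub>V\<^esub> y) = f x \<oplus>\<^bsub>W\<^esub> f y"
    and "\<And>a x. a \<in> carrier K \<Longrightarrow> x \<in> carrier V \<Longrightarrow> f (a \<odot>\<^bsub>V\<^esub> x) = a \<odot>\<^bsub>W\<^esub> f x"
  shows "f \<in> linear_maps K V W"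
  using assms by (auto simp: linear_maps_def)

lemma linear_maps_closed: "f \<in> linear_maps K V W \<Longrightarrow> x \<in> carrier V \<Longrightarrow> f x \<in> carrier W"
  by (auto simp: linear_maps_def)

lemma linear_maps_add:
  "f \<in> linear_maps K V W \<Longrightarrow> x \<in> carrier V \<Longrightarrow> y \<in> carrier V \<Longrightarrow> f (x \<oplus>\<^bsub>V\<^esub> y) = f x \<oplus>\<^bsub>W\<^esub> f y"
  by (auto simp: linear_maps_def)

lemma linear_maps_smult:
  "f \<in> linear_maps K V W \<Longrightarrow> a \<in> carrier K \<Longrightarrow> x \<in> carrier V \<Longrightarrow> f (a \<odot>\<^bsub>V\<^esub> x) = a \<odot>\<^bsub>W\<^esub> f x"
  by (auto simp: linear_maps_def)

lemma linear_maps_zero: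
  assumes "f \<in> linear_maps K V W" "module K V" "module K W"
  shows "f \<zero>\<^bsub>V\<^esub> = \<zero>\<^bsub>W\<^esub>"
proof -
  interpret V: module K V by fact
  interpret W: module K W by fact
  have "f (\<zero>\<^bsub>K\<^esub> \<odot>\<^bsub>V\<^esub> \<zero>\<^bsub>V\<^esub>) = \<zero>\<^bsub>K\<^esub> \<odot>\<^bsub>W\<^esub> f \<zero>\<^bsub>V\<^esub>"
    using assms(1) by (intro linear_maps_smult) auto
  then show ?thesis
    using linear_maps_closed[OF assms(1)] by simp
qed

lemma linear_maps_a_inv:
  assumes "f \<in> linear_maps K V W" "module K V" "module K W" "x \<in> carrier V"
  shows "f (\<ominus>\<^bsub>V\<^esub> x) = \<ominus>\<^bsub>W\<^esub> f x"
proof -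
  interpret V: module K V by fact
  interpret W: module K W by fact
  have "f (\<ominus>\<^bsub>V\<^esub> x) \<oplus>\<^bsub>W\<^esub> f x = f (\<ominus>\<^bsub>V\<^esub> x \<oplus>\<^bsub>V\<^esub> x)"
    using assms by (simp add: linear_maps_add)
  also have "\<dots> = \<zero>\<^bsub>W\<^esub>"
    using assms by (simp add: V.M.l_neg linear_maps_zero)
  finally show ?thesis
    using assms by (intro W.M.minus_equality[symmetric]) (auto intro: linear_maps_closed)
qed

lemma linear_maps_minus:
  assumes "f \<in> linear_maps K V W" "module K V" "module K W" "x \<in> carrier V" "y \<in> carrier V"
  shows "f (x \<ominus>\<^bsub>V\<^esub> y) = f x \<ominus>\<^bsub>W\<^esub> f y"
proof -
  interpret V: module K V by fact
  show ?thesis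
    using assms by (simp add: a_minus_def linear_maps_add linear_maps_a_inv)
qed

lemma linear_maps_ident: "(\<lambda>x. x) \<in> linear_maps K V V"
  by (auto simp: linear_maps_def)

lemma linear_maps_comp:
  "f \<in> linear_maps K V W \<Longrightarrow> g \<in> linear_maps K W U \<Longrightarrow> (\<lambda>x. g (f x)) \<in> linear_maps K V U"
  by (auto simp: linear_maps_def Pi_iff)

text \<open>\<open>linear_maps\<close> constrains values on the carrier only, so \<open>f\<close>
  and \<open>g\<close> may differ elsewhere. That \<open>V\<close> is a module keeps sums and
  multiples of carrier elements where the two agree.\<close>

lemma linear_maps_cong:
  assumes "module K V" "\<And>x. x \<in> carrier V \<Longrightarrow> f x = g x"
  shows "f \<in> linear_maps K V W \<longleftrightarrow> g \<in> linear_maps K V W"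
proof -
  interpret V: module K V by fact
  show ?thesis using assms(2) by (auto simp: linear_maps_def Pi_iff)
qed

section \<open>Submodules as preimages, kernels, images, equalizers and spans\<close>

lemma submodule_zero: "submodule N K V \<Longrightarrow> \<zero>\<^bsub>V\<^esub> \<in> N"
  using subgroup.one_closed[of N "add_monoid V"] by (auto simp: submodule_def)

lemma submodule_minus:
  assumes "module K V" "submodule N K V" "x \<in> N" "y \<in> N"
  shows "x \<ominus>\<^bsub>V\<^esub> y \<in> N"
  unfolding a_minus_def using assms by (intro module.submoduleE(5)[OF assms(1,2)] module.submoduleE(3))

lemma submodule_vimage:
  assumes "f \<in> linear_maps K V W" "module K V" "module K W" "submodule N K W"
  shows "submodule {x \<in> carrier V. f x \<in> N} K V"
proof -
  interpret V: module K V by fact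
  interpret W: module K W by fact
  note N = W.submoduleE[OF assms(4)]
  show ?thesis
    using N by (intro V.submoduleI)
      (auto simp: linear_maps_zero[OF assms(1-3)] linear_maps_add[OF assms(1)]
        linear_maps_smult[OF assms(1)] linear_maps_a_inv[OF assms(1-3)] submodule_zero[OF assms(4)])
qed

lemma submodule_singleton_zero: "module K V \<Longrightarrow> submodule {\<zero>\<^bsub>V\<^esub>} K V"
proof -
  assume "module K V"
  then interpret V: module K V .
  show ?thesis by (intro V.submoduleI) auto
qed

lemma submodule_kernel:
  assumes "f \<in> linear_maps K V W" "module K V" "module K W"
  shows "submodule {x \<in> carrier V. f x = \<zero>\<^bsub>W\<^esub>} K V"
  using submodule_vimage[OF assms submodule_singleton_zero[OF assms(3)]] by simp

lemma submodule_image: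
  assumes "f \<in> linear_maps K V W" "module K V" "module K W"
  shows "submodule (f ` carrier V) K W"
proof -
  interpret V: module K V by fact
  interpret W: module K W by fact
  note f = linear_maps_closed[OF assms(1)] linear_maps_add[OF assms(1), symmetric]
    linear_maps_smult[OF assms(1), symmetric] linear_maps_zero[OF assms, symmetric]
    linear_maps_a_inv[OF assms, symmetric]
  show ?thesis
    by (intro W.submoduleI) (auto simp: f)
qed

text \<open>Reduces an equality of linear maps to generators: the set of agreement is everything
  once it contains a spanning set.\<close>

lemma submodule_equalizer:
  assumes "f \<in> linear_maps K V W" "g \<in> linear_maps K V W" "module K V" "module K W"
  shows "submodule {x \<in> carrier V. f x = g x} K V"
proof -
  interpret V: module K V by fact
  interpret W: module K W by fact
  note f = linear_maps_add[OF assms(1)] linear_maps_smult[OF assms(1)]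
    linear_maps_zero[OF assms(1,3,4)] linear_maps_a_inv[OF assms(1,3,4)]
  note g = linear_maps_add[OF assms(2)] linear_maps_smult[OF assms(2)]
    linear_maps_zero[OF assms(2,3,4)] linear_maps_a_inv[OF assms(2,3,4)]
  show ?thesis
    by (intro V.submoduleI) (auto simp: f g)
qed

lemma module_span_submodule:
  assumes "module K V" "A \<subseteq> carrier V"
  shows "submodule (module_span K V A) K V"
proof -
  interpret V: module K V by fact
  \<comment> \<open>The whole carrier belongs to the intersected family, which keeps the
    intersection inside \<open>carrier V\<close>.\<close>
  have "carrier V \<in> {N. submodule N K V \<and> A \<subseteq> N}"
    using V.carrier_is_submodule assms by auto
  then have "module_span K V A \<subseteq> carrier V"
    unfolding module_span_def by (rule Inter_lower)
  then show ?thesis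
    by (intro V.submoduleI)
      (auto simp: module_span_def submodule_zero V.submoduleE)
qed

lemma module_span_superset: "A \<subseteq> module_span K V A"
  by (auto simp: module_span_def)

lemma module_span_least: "submodule N K V \<Longrightarrow> A \<subseteq> N \<Longrightarrow> module_span K V A \<subseteq> N"
  by (auto simp: module_span_def)

section \<open>Free modules and quotients\<close>

lemma free_module_simps [simp]:
  "f \<in> carrier (free_module K X) \<longleftrightarrow> (\<forall>x\<in>X. f x \<in> carrier K) \<and>
     (\<forall>x. x \<notin> X \<longrightarrow> f x = \<zero>\<^bsub>K\<^esub>) \<and> finite {x. f x \<noteq> \<zero>\<^bsub>K\<^esub>}"
  "\<zero>\<^bsub>free_module K X\<^esub> = (\<lambda>_. \<zero>\<^bsub>K\<^esub>)"
  "f \<oplus>\<^bsub>free_module K X\<^esub> g = (\<lambda>x. f x \<oplus>\<^bsub>K\<^esub> g x)"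
  "a \<odot>\<^bsub>free_module K X\<^esub> f = (\<lambda>x. a \<otimes>\<^bsub>K\<^esub> f x)"
  by (auto simp: free_module_def)

lemma free_module_apply_closed:
  assumes "cring K" "f \<in> carrier (free_module K X)"
  shows "f x \<in> carrier K"
proof -
  interpret cring K by fact
  show ?thesis using assms(2) by (cases "x \<in> X") auto
qed

lemma module_free_module:
  fixes K :: "('k, 'p) ring_scheme" and X :: "'x set"
  assumes "cring K"
  shows "module K (free_module K X)"
proof -
  interpret cring K by fact
  note cl = free_module_apply_closed[OF assms]
  have fin: "finite {x. f x \<oplus>\<^bsub>K\<^esub> g x \<noteq> \<zero>\<^bsub>K\<^esub>}"
    if "finite {x. f x \<noteq> \<zero>\<^bsub>K\<^esub>}" "finite {x. g x \<noteq> \<zero>\<^bsub>K\<^esub>}" for f g :: "'x \<Rightarrow> 'k"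
    by (rule finite_subset[OF _ finite_UnI[OF that]]) auto
  have fin': "finite {x. a \<otimes>\<^bsub>K\<^esub> f x \<noteq> \<zero>\<^bsub>K\<^esub>}"
    if "finite {x. f x \<noteq> \<zero>\<^bsub>K\<^esub>}" "a \<in> carrier K" for f :: "'x \<Rightarrow> 'k" and a
    by (rule finite_subset[OF _ that(1)]) (use that in auto)
  have ab: "abelian_group (free_module K X)"
  proof (rule abelian_groupI)
    fix f assume f: "f \<in> carrier (free_module K X)"
    show "\<exists>g\<in>carrier (free_module K X). g \<oplus>\<^bsub>free_module K X\<^esub> f = \<zero>\<^bsub>free_module K X\<^esub>"
    proof (rule bexI)
      show "(\<lambda>x. \<ominus>\<^bsub>K\<^esub> f x) \<in> carrier (free_module K X)"
        using f cl[OF f] by (auto intro: finite_subset[of _ "{x. f x \<noteq> \<zero>\<^bsub>K\<^esub>}"])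
    qed (use cl[OF f] in \<open>auto simp: l_neg\<close>)
  next
    fix f g h assume "f \<in> carrier (free_module K X)" "g \<in> carrier (free_module K X)"
      "h \<in> carrier (free_module K X)"
    note this[THEN cl]
    then show "f \<oplus>\<^bsub>free_module K X\<^esub> g \<oplus>\<^bsub>free_module K X\<^esub> h =
      f \<oplus>\<^bsub>free_module K X\<^esub> (g \<oplus>\<^bsub>free_module K X\<^esub> h)"
      by (simp add: a_assoc)
  next
    fix f g assume fg: "f \<in> carrier (free_module K X)" "g \<in> carrier (free_module K X)"
    note this[THEN cl]
    then show "f \<oplus>\<^bsub>free_module K X\<^esub> g = g \<oplus>\<^bsub>free_module K X\<^esub> f"
      by (simp add: a_comm)
    show "f \<oplus>\<^bsub>free_module K X\<^esub> g \<in> carrier (free_module K X)"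
      using fg by (auto simp: fin)
  next
    fix f assume f: "f \<in> carrier (free_module K X)"
    show "\<zero>\<^bsub>free_module K X\<^esub> \<oplus>\<^bsub>free_module K X\<^esub> f = f"
      using cl[OF f] by simp
  qed simp
  show ?thesis
  proof (rule moduleI[OF assms ab])
    fix a b f assume "a \<in> carrier K" "b \<in> carrier K" "f \<in> carrier (free_module K X)"
    then show "(a \<oplus>\<^bsub>K\<^esub> b) \<odot>\<^bsub>free_module K X\<^esub> f =
        a \<odot>\<^bsub>free_module K X\<^esub> f \<oplus>\<^bsub>free_module K X\<^esub> b \<odot>\<^bsub>free_module K X\<^esub> f"
      "a \<otimes>\<^bsub>K\<^esub> b \<odot>\<^bsub>free_module K X\<^esub> f = a \<odot>\<^bsub>free_module K X\<^esub> (b \<odot>\<^bsub>free_module K X\<^esub> f)"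
      using cl[of f] by (auto simp: l_distr m_assoc)
  next
    fix a f g assume "a \<in> carrier K" "f \<in> carrier (free_module K X)" "g \<in> carrier (free_module K X)"
    then show "a \<odot>\<^bsub>free_module K X\<^esub> (f \<oplus>\<^bsub>free_module K X\<^esub> g) =
        a \<odot>\<^bsub>free_module K X\<^esub> f \<oplus>\<^bsub>free_module K X\<^esub> a \<odot>\<^bsub>free_module K X\<^esub> g"
      using cl[of f] cl[of g] by (auto simp: r_distr)
  next
    fix f assume "f \<in> carrier (free_module K X)"
    then show "\<one>\<^bsub>K\<^esub> \<odot>\<^bsub>free_module K X\<^esub> f = f"
      using cl[of f] by auto
  qed (auto simp: fin')
qed

lemma basis_vec_closed:
  assumes "cring K" "x \<in> X"
  shows "basis_vec K x \<in> carrier (free_module K X)"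
proof -
  interpret cring K by fact
  show ?thesis using assms(2)
    by (auto simp: basis_vec_def intro: finite_subset[of _ "{x}"])
qed

text \<open>Induction on the support: resetting one coordinate to zero leaves a vector with smaller
  support, and what was removed is a scalar multiple of a basis vector.\<close>

lemma free_module_span:
  assumes "cring K" "submodule N K (free_module K X)" "\<And>x. x \<in> X \<Longrightarrow> basis_vec K x \<in> N"
    and "f \<in> carrier (free_module K X)"
  shows "f \<in> N"
proof -
  interpret cring K by fact
  interpret F: module K "free_module K X" by (rule module_free_module) fact
  note N = F.submoduleE[OF assms(2)]
  have "\<forall>f\<in>carrier (free_module K X). {x. f x \<noteq> \<zero>\<^bsub>K\<^esub>} = A \<longrightarrow> f \<in> N" if "finite A" for A
    using that
  proof (induction A rule: finite_induct)
    case empty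
    then show ?case using submodule_zero[OF assms(2)] by (auto simp: fun_eq_iff[symmetric])
  next
    case (insert x A)
    show ?case
    proof (intro ballI impI)
      fix f assume f: "f \<in> carrier (free_module K X)" and s: "{y. f y \<noteq> \<zero>\<^bsub>K\<^esub>} = insert x A"
      note cl = free_module_apply_closed[OF assms(1) f]
      have x: "x \<in> X" using f s by auto
      have fin: "finite {y. (f(x := \<zero>\<^bsub>K\<^esub>)) y \<noteq> \<zero>\<^bsub>K\<^esub>}"
        using insert s by (intro finite_subset[OF _ finite.insertI[OF \<open>finite A\<close>, of x]]) auto
      have "{y. (f(x := \<zero>\<^bsub>K\<^esub>)) y \<noteq> \<zero>\<^bsub>K\<^esub>} = A"
        using s insert by auto
      moreover have "f(x := \<zero>\<^bsub>K\<^esub>) \<in> carrier (free_module K X)"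
        using f fin by auto
      ultimately have "f(x := \<zero>\<^bsub>K\<^esub>) \<in> N"
        using insert by blast
      moreover have "f x \<odot>\<^bsub>free_module K X\<^esub> basis_vec K x \<in> N"
        using N(4) assms(3) x cl by blast
      ultimately have "f(x := \<zero>\<^bsub>K\<^esub>) \<oplus>\<^bsub>free_module K X\<^esub> (f x \<odot>\<^bsub>free_module K X\<^esub> basis_vec K x) \<in> N"
        by (rule N(5))
      also have "f(x := \<zero>\<^bsub>K\<^esub>) \<oplus>\<^bsub>free_module K X\<^esub> (f x \<odot>\<^bsub>free_module K X\<^esub> basis_vec K x) = f"
        using cl by (auto simp: fun_eq_iff basis_vec_def)
      finally show "f \<in> N" .
    qed
  qed
  from this[of "{x. f x \<noteq> \<zero>\<^bsub>K\<^esub>}"] show ?thesis using assms(4) by auto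
qed

text \<open>The sum inside \<open>tlift\<close>, for an arbitrary index type and an explicit vector
  in place of a chosen representative. Its linearity can thus be settled on the free module, before
  passing to the quotient.\<close>

definition free_lift ::
  "('k, 'p) ring_scheme \<Rightarrow> ('k, 'u, 'm) module_scheme \<Rightarrow> ('x \<Rightarrow> 'u) \<Rightarrow> ('x \<Rightarrow> 'k) \<Rightarrow> 'u"
  where "free_lift K U b t = (\<Oplus>\<^bsub>U\<^esub>z \<in> {z. t z \<noteq> \<zero>\<^bsub>K\<^esub>}. t z \<odot>\<^bsub>U\<^esub> b z)"

text \<open>Cancellation can make the support of a sum smaller than the union of the supports, so
  sums over the exact supports cannot be added termwise. A common finite index set, padded with zero
  terms, allows it.\<close>

lemma free_lift_superset:
  assumes "module K U" "b \<in> X \<rightarrow> carrier U" "t \<in> carrier (free_module K X)"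
    and "finite A" "{z. t z \<noteq> \<zero>\<^bsub>K\<^esub>} \<subseteq> A" "A \<subseteq> X"
  shows "free_lift K U b t = (\<Oplus>\<^bsub>U\<^esub>z \<in> A. t z \<odot>\<^bsub>U\<^esub> b z)"
proof -
  interpret U: module K U by fact
  show ?thesis
    unfolding free_lift_def using assms
    by (intro U.M.add.finprod_mono_neutral_cong_left) (auto simp: Pi_iff subset_iff)
qed

lemma free_lift_linear:
  assumes "module K U" "b \<in> X \<rightarrow> carrier U"
  shows "free_lift K U b \<in> linear_maps K (free_module K X) U"
proof -
  interpret U: module K U by fact
  interpret F: module K "free_module K X" by (rule module_free_module) (rule U.R.is_cring)
  note cl = free_module_apply_closed[OF U.R.is_cring]
  have sub: "{z. t z \<noteq> \<zero>\<^bsub>K\<^esub>} \<subseteq> X" if "t \<in> carrier (free_module K X)" for t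
    using that by auto
  show ?thesis
  proof (rule linear_mapsI)
    fix t assume "t \<in> carrier (free_module K X)"
    then show "free_lift K U b t \<in> carrier U"
      unfolding free_lift_def using assms(2) by (intro U.M.finsum_closed) auto
  next
    fix s t assume st: "s \<in> carrier (free_module K X)" "t \<in> carrier (free_module K X)"
    define A where "A = {z. s z \<noteq> \<zero>\<^bsub>K\<^esub>} \<union> {z. t z \<noteq> \<zero>\<^bsub>K\<^esub>}"
    have A: "finite A" "A \<subseteq> X" using st by (auto simp: A_def)
    have st': "s \<oplus>\<^bsub>free_module K X\<^esub> t \<in> carrier (free_module K X)" using st by (rule F.M.a_closed)
    have "free_lift K U b (s \<oplus>\<^bsub>free_module K X\<^esub> t)
        = (\<Oplus>\<^bsub>U\<^esub>z \<in> A. (s \<oplus>\<^bsub>free_module K X\<^esub> t) z \<odot>\<^bsub>U\<^esub> b z)"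
      using A by (intro free_lift_superset[OF assms st']) (auto simp: A_def)
    also have "\<dots> = (\<Oplus>\<^bsub>U\<^esub>z \<in> A. s z \<odot>\<^bsub>U\<^esub> b z \<oplus>\<^bsub>U\<^esub> t z \<odot>\<^bsub>U\<^esub> b z)"
      using A assms(2) cl[OF st(1)] cl[OF st(2)]
      by (intro U.M.add.finprod_cong') (auto simp: U.smult_l_distr Pi_iff subset_iff)
    also have "\<dots> = (\<Oplus>\<^bsub>U\<^esub>z \<in> A. s z \<odot>\<^bsub>U\<^esub> b z) \<oplus>\<^bsub>U\<^esub> (\<Oplus>\<^bsub>U\<^esub>z \<in> A. t z \<odot>\<^bsub>U\<^esub> b z)"
      using A assms(2) cl[OF st(1)] cl[OF st(2)]
      by (intro U.M.finsum_addf) (auto simp: Pi_iff subset_iff)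
    also have "\<dots> = free_lift K U b s \<oplus>\<^bsub>U\<^esub> free_lift K U b t"
      using free_lift_superset[OF assms st(1) A(1) _ A(2)] free_lift_superset[OF assms st(2) A(1) _ A(2)]
      by (auto simp: A_def)
    finally show "free_lift K U b (s \<oplus>\<^bsub>free_module K X\<^esub> t) = free_lift K U b s \<oplus>\<^bsub>U\<^esub> free_lift K U b t" .
  next
    fix a t assume at: "a \<in> carrier K" "t \<in> carrier (free_module K X)"
    define A where "A = {z. t z \<noteq> \<zero>\<^bsub>K\<^esub>}"
    have A: "finite A" "A \<subseteq> X" using at by (auto simp: A_def)
    have at': "a \<odot>\<^bsub>free_module K X\<^esub> t \<in> carrier (free_module K X)" using at by (rule F.smult_closed)
    have "free_lift K U b (a \<odot>\<^bsub>free_module K X\<^esub> t)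
        = (\<Oplus>\<^bsub>U\<^esub>z \<in> A. (a \<odot>\<^bsub>free_module K X\<^esub> t) z \<odot>\<^bsub>U\<^esub> b z)"
      using A at by (intro free_lift_superset[OF assms at']) (auto simp: A_def)
    also have "\<dots> = (\<Oplus>\<^bsub>U\<^esub>z \<in> A. a \<odot>\<^bsub>U\<^esub> (t z \<odot>\<^bsub>U\<^esub> b z))"
      using A assms(2) cl[OF at(2)] at(1)
      by (intro U.M.add.finprod_cong') (auto simp: U.smult_assoc1 Pi_iff subset_iff)
    also have "\<dots> = a \<odot>\<^bsub>U\<^esub> (\<Oplus>\<^bsub>U\<^esub>z \<in> A. t z \<odot>\<^bsub>U\<^esub> b z)"
      using A assms(2) cl[OF at(2)] at(1)
      by (intro U.finsum_smult_ldistr[symmetric]) (auto simp: Pi_iff subset_iff)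
    finally show "free_lift K U b (a \<odot>\<^bsub>free_module K X\<^esub> t) = a \<odot>\<^bsub>U\<^esub> free_lift K U b t"
      by (simp add: free_lift_def A_def)
  qed
qed

lemma free_lift_basis_vec:
  assumes "module K U" "b \<in> X \<rightarrow> carrier U" "x \<in> X"
  shows "free_lift K U b (basis_vec K x) = b x"
proof -
  interpret U: module K U by fact
  have "free_lift K U b (basis_vec K x) = (\<Oplus>\<^bsub>U\<^esub>z \<in> {x}. basis_vec K x z \<odot>\<^bsub>U\<^esub> b z)"
    using assms(3) by (intro free_lift_superset[OF assms(1,2) basis_vec_closed[OF U.R.is_cring]])
      (auto simp: basis_vec_def)
  also have "\<dots> = b x"
    using assms by (auto simp: basis_vec_def Pi_iff)
  finally show ?thesis .
qed

section \<open>Quotients by a submodule\<close>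

lemma quotient_module_coset:
  assumes "module K V" "submodule N K V"
  shows "module K (quotient_module V N)"
    and "(\<lambda>x. N +>\<^bsub>V\<^esub> x) \<in> linear_maps K V (quotient_module V N)"
    and "carrier (quotient_module V N) = (\<lambda>x. N +>\<^bsub>V\<^esub> x) ` carrier V"
    and "\<And>x y. x \<in> carrier V \<Longrightarrow> y \<in> carrier V \<Longrightarrow> N +>\<^bsub>V\<^esub> x = N +>\<^bsub>V\<^esub> y \<longleftrightarrow> x \<ominus>\<^bsub>V\<^esub> y \<in> N"
    and "\<And>x. x \<in> carrier V \<Longrightarrow> x \<in> N +>\<^bsub>V\<^esub> x"
proof -
  interpret V: module K V by fact
  interpret N: abelian_subgroup N V
    using assms(2) by (intro abelian_subgroupI3 additive_subgroupI V.M.abelian_group_axioms)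
      (simp add: submodule_def)
  let ?Q = "quotient_module V N"
  note subN = V.submoduleE[OF assms(2)]
  show carr: "carrier ?Q = (\<lambda>x. N +>\<^bsub>V\<^esub> x) ` carrier V"
    by (auto simp: quotient_module_def A_RCOSETS_def')
  show self: "\<And>x. x \<in> carrier V \<Longrightarrow> x \<in> N +>\<^bsub>V\<^esub> x"
    by (rule N.a_rcos_self)
  have sub: "\<And>x. x \<in> carrier V \<Longrightarrow> N +>\<^bsub>V\<^esub> x \<subseteq> carrier V"
    by (rule V.M.a_r_coset_subset_G[OF N.a_subset])
  show eq: "N +>\<^bsub>V\<^esub> x = N +>\<^bsub>V\<^esub> y \<longleftrightarrow> x \<ominus>\<^bsub>V\<^esub> y \<in> N" if "x \<in> carrier V" "y \<in> carrier V" for x y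
  proof
    assume "N +>\<^bsub>V\<^esub> x = N +>\<^bsub>V\<^esub> y"
    then have "x \<in> N +>\<^bsub>V\<^esub> y" using self that by auto
    then obtain n where n: "n \<in> N" "x = n \<oplus>\<^bsub>V\<^esub> y" by (auto simp: a_r_coset_def')
    then have "x \<ominus>\<^bsub>V\<^esub> y = n"
      using that subN(1) by (auto simp: a_minus_def V.M.a_assoc V.M.r_neg)
    then show "x \<ominus>\<^bsub>V\<^esub> y \<in> N" using n by simp
  next
    assume n: "x \<ominus>\<^bsub>V\<^esub> y \<in> N"
    have "x = (x \<ominus>\<^bsub>V\<^esub> y) \<oplus>\<^bsub>V\<^esub> y"
      using that by (simp add: a_minus_def V.M.a_assoc V.M.l_neg)
    then have "x \<in> N +>\<^bsub>V\<^esub> y" using n by (auto simp: a_r_coset_def')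
    from V.M.a_repr_independence[OF this that(2) N.a_subgroup] show "N +>\<^bsub>V\<^esub> x = N +>\<^bsub>V\<^esub> y" by simp
  qed
  have add: "(N +>\<^bsub>V\<^esub> x) \<oplus>\<^bsub>?Q\<^esub> (N +>\<^bsub>V\<^esub> y) = N +>\<^bsub>V\<^esub> (x \<oplus>\<^bsub>V\<^esub> y)"
    if "x \<in> carrier V" "y \<in> carrier V" for x y
    using N.a_rcos_sum[OF that] by (simp add: quotient_module_def)
  have smult: "a \<odot>\<^bsub>?Q\<^esub> (N +>\<^bsub>V\<^esub> x) = N +>\<^bsub>V\<^esub> (a \<odot>\<^bsub>V\<^esub> x)"
    if a: "a \<in> carrier K" and x: "x \<in> carrier V" for a x
  proof -
    \<comment> \<open>Scalar multiplication on the quotient is a union over the coset. All cosets in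
      that union coincide, since \<open>y\<close> and \<open>x\<close> differ by an element of
      \<open>N\<close> and so do their multiples; the index set is nonempty because it contains
      \<open>x\<close>.\<close>
    have "N +>\<^bsub>V\<^esub> (a \<odot>\<^bsub>V\<^esub> y) = N +>\<^bsub>V\<^esub> (a \<odot>\<^bsub>V\<^esub> x)" if y: "y \<in> N +>\<^bsub>V\<^esub> x" for y
    proof -
      have yc: "y \<in> carrier V" using y sub[OF x] by auto
      have "y \<ominus>\<^bsub>V\<^esub> x \<in> N"
        using V.M.a_repr_independence[OF y x N.a_subgroup] eq[OF yc x] by simp
      then have "a \<odot>\<^bsub>V\<^esub> (y \<ominus>\<^bsub>V\<^esub> x) \<in> N" using a subN(4) by blast
      then have "a \<odot>\<^bsub>V\<^esub> y \<ominus>\<^bsub>V\<^esub> a \<odot>\<^bsub>V\<^esub> x \<in> N"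
        using a x yc by (simp add: a_minus_def V.smult_r_distr V.smult_r_minus)
      then show ?thesis using eq a x yc by blast
    qed
    then have "(\<Union>y\<in>N +>\<^bsub>V\<^esub> x. N +>\<^bsub>V\<^esub> (a \<odot>\<^bsub>V\<^esub> y)) = (\<Union>y\<in>N +>\<^bsub>V\<^esub> x. N +>\<^bsub>V\<^esub> (a \<odot>\<^bsub>V\<^esub> x))"
      by (rule SUP_cong[OF refl])
    also have "\<dots> = N +>\<^bsub>V\<^esub> (a \<odot>\<^bsub>V\<^esub> x)"
      using self[OF x] by (subst UN_constant) (simp only: if_not_P empty_iff split: if_split, blast)
    finally show ?thesis by (simp add: quotient_module_def)
  qed
  have zero: "\<zero>\<^bsub>?Q\<^esub> = N +>\<^bsub>V\<^esub> \<zero>\<^bsub>V\<^esub>"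
    using V.M.a_coset_add_zero[OF subN(1)] by (simp add: quotient_module_def)
  have ab: "abelian_group ?Q"
  proof (rule abelian_groupI)
    fix A assume "A \<in> carrier ?Q"
    then obtain x where x: "A = N +>\<^bsub>V\<^esub> x" "x \<in> carrier V" by (auto simp: carr)
    show "\<exists>B\<in>carrier ?Q. B \<oplus>\<^bsub>?Q\<^esub> A = \<zero>\<^bsub>?Q\<^esub>"
      by (rule bexI[of _ "N +>\<^bsub>V\<^esub> (\<ominus>\<^bsub>V\<^esub> x)"]) (auto simp: x add zero carr V.M.l_neg)
  qed (auto simp: carr add zero V.M.a_ac)
  show "module K ?Q"
    by (rule moduleI[OF V.R.is_cring ab])
      (auto simp: carr add smult V.smult_l_distr V.smult_r_distr V.smult_assoc1)
  show "(\<lambda>x. N +>\<^bsub>V\<^esub> x) \<in> linear_maps K V ?Q"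
    by (rule linear_mapsI) (auto simp: carr add smult)
qed

section \<open>Tensor products\<close>

text \<open>Encoded as linearity in each slot, so that fixing one argument yields an element of
  \<open>linear_maps\<close>, ready to be composed with further linear maps.\<close>

definition bilinear_maps ::
  "('k, 'p) ring_scheme \<Rightarrow> ('k, 'v, 'm) module_scheme \<Rightarrow> ('k, 'w, 'n) module_scheme
    \<Rightarrow> ('k, 'u, 'l) module_scheme \<Rightarrow> ('v \<Rightarrow> 'w \<Rightarrow> 'u) set"
  where "bilinear_maps K V W U = {b. (\<forall>v\<in>carrier V. b v \<in> linear_maps K W U) \<and>
    (\<forall>w\<in>carrier W. (\<lambda>v. b v w) \<in> linear_maps K V U)}"

lemma bilinear_mapsI:
  assumes "\<And>v. v \<in> carrier V \<Longrightarrow> b v \<in> linear_maps K W U"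
    and "\<And>w. w \<in> carrier W \<Longrightarrow> (\<lambda>v. b v w) \<in> linear_maps K V U"
  shows "b \<in> bilinear_maps K V W U"
  using assms by (auto simp: bilinear_maps_def)

lemma bilinear_mapsD:
  assumes "b \<in> bilinear_maps K V W U"
  shows "v \<in> carrier V \<Longrightarrow> b v \<in> linear_maps K W U"
    and "w \<in> carrier W \<Longrightarrow> (\<lambda>v. b v w) \<in> linear_maps K V U"
  using assms by (auto simp: bilinear_maps_def)

lemma bilinear_maps_closed:
  "b \<in> bilinear_maps K V W U \<Longrightarrow> v \<in> carrier V \<Longrightarrow> w \<in> carrier W \<Longrightarrow> b v w \<in> carrier U"
  by (blast dest: bilinear_mapsD(1) linear_maps_closed)

lemma bilinear_maps_comp:
  assumes "b \<in> bilinear_maps K V W U" "f \<in> linear_maps K V' V" "g \<in> linear_maps K W' W"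
  shows "(\<lambda>v w. b (f v) (g w)) \<in> bilinear_maps K V' W' U"
proof (rule bilinear_mapsI)
  fix v assume "v \<in> carrier V'"
  then have "b (f v) \<in> linear_maps K W U"
    using assms by (blast intro: bilinear_mapsD linear_maps_closed)
  with assms(3) show "(\<lambda>w. b (f v) (g w)) \<in> linear_maps K W' U" by (rule linear_maps_comp)
next
  fix w assume "w \<in> carrier W'"
  then have "(\<lambda>v. b v (g w)) \<in> linear_maps K V U"
    using assms by (blast intro: bilinear_mapsD linear_maps_closed)
  with assms(2) show "(\<lambda>v. b (f v) (g w)) \<in> linear_maps K V' U" by (rule linear_maps_comp)
qed

lemma linear_comp_bilinear:
  assumes "b \<in> bilinear_maps K V W U" "f \<in> linear_maps K U U'"
  shows "(\<lambda>v w. f (b v w)) \<in> bilinear_maps K V W U'"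
  using assms by (intro bilinear_mapsI) (auto intro: linear_maps_comp bilinear_mapsD)

context
  fixes K :: "('k, 'p) ring_scheme"
    and V :: "('k, 'v, 'm) module_scheme" and W :: "('k, 'w, 'n) module_scheme"
  assumes mod_V: "module K V" and mod_W: "module K W"
begin

interpretation V: module K V by (rule mod_V)
interpretation W: module K W by (rule mod_W)

abbreviation (input) "F \<equiv> free_module K (carrier V \<times> carrier W)"

interpretation F: module K F by (rule module_free_module) (rule V.R.is_cring)

lemma bilinear_rels_subset: "bilinear_rels K V W \<subseteq> carrier F"
proof -
  have e: "basis_vec K (v, w) \<in> carrier F" if "v \<in> carrier V" "w \<in> carrier W" for v w
    using that by (intro basis_vec_closed V.R.is_cring) auto
  show ?thesis
    unfolding bilinear_rels_def Let_def
    by (auto simp del: free_module_simps intro!: F.M.minus_closed F.M.a_closed F.smult_closed e)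
qed

lemma tensor_null_submodule: "submodule (tensor_null K V W) K F"
  unfolding tensor_null_def by (intro module_span_submodule F.module_axioms bilinear_rels_subset)

lemma module_tensor: "module K (tensor K V W)"
  unfolding tensor_def by (intro quotient_module_coset(1) F.module_axioms tensor_null_submodule)

lemma tensor_coset_linear:
  "(\<lambda>t. tensor_null K V W +>\<^bsub>F\<^esub> t) \<in> linear_maps K F (tensor K V W)"
  unfolding tensor_def by (intro quotient_module_coset(2) F.module_axioms tensor_null_submodule)

lemma carrier_tensor: "carrier (tensor K V W) = (\<lambda>t. tensor_null K V W +>\<^bsub>F\<^esub> t) ` carrier F"
  unfolding tensor_def by (rule quotient_module_coset(3)[OF F.module_axioms tensor_null_submodule])

lemmas tensor_coset =
  quotient_module_coset(4,5)[OF F.module_axioms tensor_null_submodule]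

text \<open>Each of the four families in \<open>bilinear_rels\<close> is one of the required
  equations: cosets agree when the difference of their representatives lies in
  \<open>tensor_null\<close>.\<close>

lemma tpure_bilinear: "tpure K V W \<in> bilinear_maps K V W (tensor K V W)"
proof -
  let ?e = "basis_vec K" let ?p = "\<lambda>t. tensor_null K V W +>\<^bsub>F\<^esub> t"
  have e: "?e (v, w) \<in> carrier F" if "v \<in> carrier V" "w \<in> carrier W" for v w
    using that by (intro basis_vec_closed V.R.is_cring) auto
  have rels: "bilinear_rels K V W \<subseteq> tensor_null K V W"
    unfolding tensor_null_def by (rule module_span_superset)
  note p = tensor_coset_linear
  note simps = tpure_def linear_maps_add[OF p, symmetric] linear_maps_smult[OF p, symmetric]
    tensor_coset(1) e F.M.a_closed F.smult_closed
  show ?thesis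
  proof (intro bilinear_mapsI linear_mapsI)
    fix v w assume "v \<in> carrier V" "w \<in> carrier W"
    \<comment> \<open>Linearity in either slot asks for closure of the same value, hence the
      repeated statement.\<close>
    then show "tpure K V W v w \<in> carrier (tensor K V W)" "tpure K V W v w \<in> carrier (tensor K V W)"
      unfolding tpure_def using linear_maps_closed[OF p] e by blast+
  next
    fix v w w' assume "v \<in> carrier V" "w \<in> carrier W" "w' \<in> carrier W"
    moreover from this have "?e (v, w \<oplus>\<^bsub>W\<^esub> w') \<ominus>\<^bsub>F\<^esub> (?e (v, w) \<oplus>\<^bsub>F\<^esub> ?e (v, w')) \<in> bilinear_rels K V W"
      unfolding bilinear_rels_def Let_def by blast
    ultimately show "tpure K V W v (w \<oplus>\<^bsub>W\<^esub> w') = tpure K V W v w \<oplus>\<^bsub>tensor K V W\<^esub> tpure K V W v w'"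
      using rels by (auto simp: simps simp del: free_module_simps)
  next
    fix v v' w assume "v \<in> carrier V" "v' \<in> carrier V" "w \<in> carrier W"
    moreover from this have "?e (v \<oplus>\<^bsub>V\<^esub> v', w) \<ominus>\<^bsub>F\<^esub> (?e (v, w) \<oplus>\<^bsub>F\<^esub> ?e (v', w)) \<in> bilinear_rels K V W"
      unfolding bilinear_rels_def Let_def by blast
    ultimately show "tpure K V W (v \<oplus>\<^bsub>V\<^esub> v') w = tpure K V W v w \<oplus>\<^bsub>tensor K V W\<^esub> tpure K V W v' w"
      using rels by (auto simp: simps simp del: free_module_simps)
  next
    fix a v w assume "a \<in> carrier K" "v \<in> carrier V" "w \<in> carrier W"
    moreover from this have "?e (v, a \<odot>\<^bsub>W\<^esub> w) \<ominus>\<^bsub>F\<^esub> (a \<odot>\<^bsub>F\<^esub> ?e (v, w)) \<in> bilinear_rels K V W"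
      "?e (a \<odot>\<^bsub>V\<^esub> v, w) \<ominus>\<^bsub>F\<^esub> (a \<odot>\<^bsub>F\<^esub> ?e (v, w)) \<in> bilinear_rels K V W"
      unfolding bilinear_rels_def Let_def by blast+
    ultimately show "tpure K V W v (a \<odot>\<^bsub>W\<^esub> w) = a \<odot>\<^bsub>tensor K V W\<^esub> tpure K V W v w"
      "tpure K V W (a \<odot>\<^bsub>V\<^esub> v) w = a \<odot>\<^bsub>tensor K V W\<^esub> tpure K V W v w"
      using rels by (auto simp: simps simp del: free_module_simps)
  qed
qed

lemma tpure_closed:
  "v \<in> carrier V \<Longrightarrow> w \<in> carrier W \<Longrightarrow> tpure K V W v w \<in> carrier (tensor K V W)"
  by (rule bilinear_maps_closed[OF tpure_bilinear])

text \<open>Pure tensors are the cosets of the basis vectors, so the preimage of \<open>N\<close> in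
  the free module contains a basis and is therefore everything.\<close>

lemma tensor_span:
  assumes "submodule N K (tensor K V W)"
    and "\<And>v w. v \<in> carrier V \<Longrightarrow> w \<in> carrier W \<Longrightarrow> tpure K V W v w \<in> N"
    and "t \<in> carrier (tensor K V W)"
  shows "t \<in> N"
proof -
  have *: "submodule {f \<in> carrier F. tensor_null K V W +>\<^bsub>F\<^esub> f \<in> N} K F"
    by (rule submodule_vimage[OF tensor_coset_linear F.module_axioms module_tensor assms(1)])
  obtain f where f: "f \<in> carrier F" "t = tensor_null K V W +>\<^bsub>F\<^esub> f"
    using assms(3) by (auto simp: carrier_tensor simp del: free_module_simps)
  have "f \<in> {f \<in> carrier F. tensor_null K V W +>\<^bsub>F\<^esub> f \<in> N}"
    using assms(2) by (intro free_module_span[OF V.R.is_cring * _ f(1)])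
      (auto simp: tpure_def basis_vec_closed[OF V.R.is_cring] simp del: free_module_simps)
  then show ?thesis using f by simp
qed

text \<open>The main device for Sweedler sums: both sides of an identity are presented as linear
  maps of the tensor and compared on pure tensors.\<close>

lemma tensor_ext:
  assumes "module K U" "f \<in> linear_maps K (tensor K V W) U" "g \<in> linear_maps K (tensor K V W) U"
    and "\<And>v w. v \<in> carrier V \<Longrightarrow> w \<in> carrier W \<Longrightarrow> f (tpure K V W v w) = g (tpure K V W v w)"
    and "t \<in> carrier (tensor K V W)"
  shows "f t = g t"
proof -
  have "t \<in> {t \<in> carrier (tensor K V W). f t = g t}"
    by (rule tensor_span[OF submodule_equalizer[OF assms(2,3) module_tensor assms(1)] _ assms(5)])
      (auto simp: tpure_closed assms(4))
  then show ?thesis by simp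
qed

text \<open>Independence of the representative that \<open>tlift\<close> picks. The linear extension
  of a bilinear \<open>b\<close> sends every bilinearity relation to zero, hence vanishes on their
  span \<open>tensor_null\<close>, and the picked representative differs from \<open>f\<close> by an
  element of that span.\<close>

lemma tlift_coset:
  assumes "module K U" "b \<in> bilinear_maps K V W U" "f \<in> carrier F"
  shows "tlift K U b (tensor_null K V W +>\<^bsub>F\<^esub> f) = free_lift K U (\<lambda>z. b (fst z) (snd z)) f"
proof -
  interpret U: module K U by fact
  let ?l = "free_lift K U (\<lambda>z. b (fst z) (snd z))"
  let ?e = "basis_vec K"
  have b: "(\<lambda>z. b (fst z) (snd z)) \<in> carrier V \<times> carrier W \<rightarrow> carrier U"
    using bilinear_maps_closed[OF assms(2)] by auto
  note lin = free_lift_linear[OF assms(1) b]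
  have le: "?l (?e (v, w)) = b v w" if "v \<in> carrier V" "w \<in> carrier W" for v w
    using free_lift_basis_vec[OF assms(1) b, of "(v, w)"] that by simp
  have e: "?e (v, w) \<in> carrier F" if "v \<in> carrier V" "w \<in> carrier W" for v w
    using that by (intro basis_vec_closed V.R.is_cring) auto
  note bl = bilinear_mapsD[OF assms(2)]
  note simps = linear_maps_minus[OF lin F.module_axioms assms(1)] linear_maps_add[OF lin]
    linear_maps_smult[OF lin] le e linear_maps_add[OF bl(1)] linear_maps_add[OF bl(2)]
    linear_maps_smult[OF bl(1)] linear_maps_smult[OF bl(2)] bilinear_maps_closed[OF assms(2)]
    F.M.minus_closed F.M.a_closed F.smult_closed U.M.r_neg a_minus_def[of U]
  have "bilinear_rels K V W \<subseteq> {t \<in> carrier F. ?l t = \<zero>\<^bsub>U\<^esub>}"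
    unfolding bilinear_rels_def Let_def by (auto simp: simps simp del: free_module_simps)
  then have null: "tensor_null K V W \<subseteq> {t \<in> carrier F. ?l t = \<zero>\<^bsub>U\<^esub>}"
    unfolding tensor_null_def
    by (intro module_span_least submodule_kernel lin F.module_axioms assms(1))
  define t where "t = (SOME t. t \<in> tensor_null K V W +>\<^bsub>F\<^esub> f)"
  have "t \<in> tensor_null K V W +>\<^bsub>F\<^esub> f"
    unfolding t_def by (rule someI[of _ f]) (rule tensor_coset(2)[OF assms(3)])
  then obtain n where n: "n \<in> tensor_null K V W" "t = n \<oplus>\<^bsub>F\<^esub> f"
    by (auto simp: a_r_coset_def' simp del: free_module_simps)
  have "?l t = ?l n \<oplus>\<^bsub>U\<^esub> ?l f"
    using n null assms(3) by (auto simp: linear_maps_add[OF lin] simp del: free_module_simps)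
  also have "\<dots> = ?l f"
    using n null assms(3) linear_maps_closed[OF lin] by auto
  finally show ?thesis
    by (simp add: tlift_def Let_def free_lift_def t_def)
qed

lemma tlift_linear:
  assumes "module K U" "b \<in> bilinear_maps K V W U"
  shows "tlift K U b \<in> linear_maps K (tensor K V W) U"
proof -
  let ?l = "free_lift K U (\<lambda>z. b (fst z) (snd z))"
  have b: "(\<lambda>z. b (fst z) (snd z)) \<in> carrier V \<times> carrier W \<rightarrow> carrier U"
    using bilinear_maps_closed[OF assms(2)] by auto
  note lin = free_lift_linear[OF assms(1) b]
  note p = tensor_coset_linear
  note simps = tlift_coset[OF assms] linear_maps_add[OF p, symmetric] linear_maps_smult[OF p, symmetric]
    linear_maps_add[OF lin] linear_maps_smult[OF lin] F.M.a_closed F.smult_closed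
    linear_maps_closed[OF lin]
  show ?thesis
    by (rule linear_mapsI) (auto simp: carrier_tensor simps simp del: free_module_simps)
qed

lemma tlift_tpure:
  assumes "module K U" "b \<in> bilinear_maps K V W U" "v \<in> carrier V" "w \<in> carrier W"
  shows "tlift K U b (tpure K V W v w) = b v w"
proof -
  have b: "(\<lambda>z. b (fst z) (snd z)) \<in> carrier V \<times> carrier W \<rightarrow> carrier U"
    using bilinear_maps_closed[OF assms(2)] by auto
  have "basis_vec K (v, w) \<in> carrier F"
    using assms by (intro basis_vec_closed V.R.is_cring) auto
  with free_lift_basis_vec[OF assms(1) b, of "(v, w)"] assms show ?thesis
    by (simp add: tpure_def tlift_coset del: free_module_simps)
qed

text \<open>Rewriting under a Sweedler sum is justified only for arguments in the carriers, so
  \<open>b'\<close> and \<open>b\<close> may differ elsewhere; agreement on the carriers is enough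
  to pass bilinearity from \<open>b\<close> to \<open>b'\<close>.\<close>

lemma tlift_cong:
  assumes "module K U" "b \<in> bilinear_maps K V W U"
    and "\<And>v w. v \<in> carrier V \<Longrightarrow> w \<in> carrier W \<Longrightarrow> b' v w = b v w"
    and "t \<in> carrier (tensor K V W)"
  shows "tlift K U b' t = tlift K U b t"
proof -
  have b': "b' \<in> bilinear_maps K V W U"
    using assms(2,3) linear_maps_cong[OF mod_V] linear_maps_cong[OF mod_W]
    unfolding bilinear_maps_def by (smt (verit, best) mem_Collect_eq)
  show ?thesis
    by (rule tensor_ext[OF assms(1) tlift_linear[OF assms(1) b'] tlift_linear[OF assms(1,2)] _ assms(4)])
      (simp add: tlift_tpure assms b')
qed

text \<open>Moves a linear map inside a Sweedler sum; with it, an identity in a threefold tensor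
  product can be contracted to one in a twofold product.\<close>

lemma linear_tlift:
  assumes "module K U" "module K U'" "b \<in> bilinear_maps K V W U" "f \<in> linear_maps K U U'"
    and "t \<in> carrier (tensor K V W)"
  shows "f (tlift K U b t) = tlift K U' (\<lambda>v w. f (b v w)) t"
proof -
  note fb = linear_comp_bilinear[OF assms(3,4)]
  show ?thesis
    by (rule tensor_ext[OF assms(2) linear_maps_comp[OF tlift_linear[OF assms(1,3)] assms(4)]
          tlift_linear[OF assms(2) fb] _ assms(5)])
      (simp add: tlift_tpure assms fb)
qed

lemma tlift_tpure_self:
  assumes "t \<in> carrier (tensor K V W)"
  shows "tlift K (tensor K V W) (tpure K V W) t = t"
  by (rule tensor_ext[OF module_tensor tlift_linear[OF module_tensor tpure_bilinear]
        linear_maps_ident _ assms])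
    (simp add: tlift_tpure module_tensor tpure_bilinear)

text \<open>In nested Sweedler sums the inner sum must depend linearly on the outer variable
  \<open>z\<close>. Both sides of the additivity or homogeneity equation are linear in the tensor
  \<open>t\<close>, so the equation can be checked on pure tensors, where the assumption on
  \<open>b\<close> applies.\<close>

lemma tlift_linear_param:
  assumes "module K U" "module K Z"
    and "\<And>z. z \<in> carrier Z \<Longrightarrow> b z \<in> bilinear_maps K V W U"
    and "\<And>v w. v \<in> carrier V \<Longrightarrow> w \<in> carrier W \<Longrightarrow> (\<lambda>z. b z v w) \<in> linear_maps K Z U"
    and "t \<in> carrier (tensor K V W)"
  shows "(\<lambda>z. tlift K U (b z) t) \<in> linear_maps K Z U"
proof -
  interpret U: module K U by fact
  interpret Z: module K Z by fact
  note lin = tlift_linear[OF assms(1,3)]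
  have cl: "tlift K U (b z) s \<in> carrier U" if "z \<in> carrier Z" "s \<in> carrier (tensor K V W)" for z s
    using linear_maps_closed[OF lin] that by blast
  note simps = linear_maps_add[OF lin] linear_maps_smult[OF lin] cl tlift_tpure[OF assms(1,3)]
    linear_maps_add[OF assms(4)] linear_maps_smult[OF assms(4)]
  show ?thesis
  proof (rule linear_mapsI)
    fix y z assume yz: "y \<in> carrier Z" "z \<in> carrier Z"
    have "(\<lambda>s. tlift K U (b y) s \<oplus>\<^bsub>U\<^esub> tlift K U (b z) s) \<in> linear_maps K (tensor K V W) U"
      using yz by (intro linear_mapsI) (auto simp: simps U.M.a_ac U.smult_r_distr)
    from tensor_ext[OF assms(1) lin this _ assms(5)] yz
    show "tlift K U (b (y \<oplus>\<^bsub>Z\<^esub> z)) t = tlift K U (b y) t \<oplus>\<^bsub>U\<^esub> tlift K U (b z) t"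
      by (simp add: simps)
  next
    fix a z assume az: "a \<in> carrier K" "z \<in> carrier Z"
    \<comment> \<open>Linearity in \<open>s\<close> of this multiple rests on the commutativity of
      \<open>K\<close>.\<close>
    have "(\<lambda>s. a \<odot>\<^bsub>U\<^esub> tlift K U (b z) s) \<in> linear_maps K (tensor K V W) U"
      using az by (intro linear_mapsI)
        (auto simp: simps U.smult_r_distr U.smult_assoc1[symmetric] V.R.m_comm)
    from tensor_ext[OF assms(1) lin this _ assms(5)] az
    show "tlift K U (b (a \<odot>\<^bsub>Z\<^esub> z)) t = a \<odot>\<^bsub>U\<^esub> tlift K U (b z) t"
      by (simp add: simps)
  qed (use cl assms(5) in auto)
qed

text \<open>Certifies a nested Sweedler expression as bilinear in its two outer variables, one of
  which is split further by \<open>\<phi>\<close>. The two orders serve sums that split the second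
  or the first tensor factor; in the applications \<open>\<phi>\<close> is a comultiplication, a
  comultiplication after \<open>p\<close>, or the identity.\<close>

lemma tlift_bilinear_param:
  assumes "module K U" "module K Z"
    and "\<And>z. z \<in> carrier Z \<Longrightarrow> b z \<in> bilinear_maps K V W U"
    and "\<And>v w. v \<in> carrier V \<Longrightarrow> w \<in> carrier W \<Longrightarrow> (\<lambda>z. b z v w) \<in> linear_maps K Z U"
    and "\<phi> \<in> linear_maps K C (tensor K V W)"
  shows "(\<lambda>z c. tlift K U (b z) (\<phi> c)) \<in> bilinear_maps K Z C U"
    and "(\<lambda>c z. tlift K U (b z) (\<phi> c)) \<in> bilinear_maps K C Z U"
proof -
  have 1: "(\<lambda>c. tlift K U (b z) (\<phi> c)) \<in> linear_maps K C U" if "z \<in> carrier Z" for z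
    by (rule linear_maps_comp[OF assms(5) tlift_linear[OF assms(1) assms(3)[OF that]]])
  have 2: "(\<lambda>z. tlift K U (b z) (\<phi> c)) \<in> linear_maps K Z U" if "c \<in> carrier C" for c
    using assms(1-4) linear_maps_closed[OF assms(5) that] by (rule tlift_linear_param)
  show "(\<lambda>z c. tlift K U (b z) (\<phi> c)) \<in> bilinear_maps K Z C U"
    and "(\<lambda>c z. tlift K U (b z) (\<phi> c)) \<in> bilinear_maps K C Z U"
    using 1 2 by (auto intro: bilinear_mapsI)
qed

end

section \<open>Functoriality of the tensor product\<close>

lemma tmap_pure_bilinear:
  assumes "module K V" "module K W" "f \<in> linear_maps K A V" "g \<in> linear_maps K B W"
  shows "(\<lambda>x y. tpure K V W (f x) (g y)) \<in> bilinear_maps K A B (tensor K V W)"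
  by (rule bilinear_maps_comp[OF tpure_bilinear[OF assms(1,2)] assms(3,4)])

lemma tmap_linear:
  assumes "module K A" "module K B" "module K V" "module K W"
    and "f \<in> linear_maps K A V" "g \<in> linear_maps K B W"
  shows "tmap K V W f g \<in> linear_maps K (tensor K A B) (tensor K V W)"
  unfolding tmap_def
  by (rule tlift_linear[OF assms(1,2) module_tensor[OF assms(3,4)] tmap_pure_bilinear[OF assms(3-6)]])

lemma tmap_tpure:
  assumes "module K A" "module K B" "module K V" "module K W"
    and "f \<in> linear_maps K A V" "g \<in> linear_maps K B W" "a \<in> carrier A" "b \<in> carrier B"
  shows "tmap K V W f g (tpure K A B a b) = tpure K V W (f a) (g b)"
  unfolding tmap_def
  by (rule tlift_tpure[OF assms(1,2) module_tensor[OF assms(3,4)] tmap_pure_bilinear[OF assms(3-6)] assms(7,8)])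

lemma tlift_tmap:
  assumes "module K A" "module K B" "module K V" "module K W" "module K U"
    and "f \<in> linear_maps K A V" "g \<in> linear_maps K B W" "b \<in> bilinear_maps K V W U"
    and "t \<in> carrier (tensor K A B)"
  shows "tlift K U b (tmap K V W f g t) = tlift K U (\<lambda>x y. b (f x) (g y)) t"
proof -
  note b = bilinear_maps_comp[OF assms(8,6,7)]
  show ?thesis
    by (rule tensor_ext[OF assms(1,2,5) linear_maps_comp[OF tmap_linear[OF assms(1-4,6,7)]
          tlift_linear[OF assms(3,4,5,8)]] tlift_linear[OF assms(1,2,5) b] _ assms(9)])
      (simp add: tmap_tpure[OF assms(1-4,6,7)] tlift_tpure[OF assms(1,2,5) b]
        tlift_tpure[OF assms(3,4,5,8)] linear_maps_closed[OF assms(6)] linear_maps_closed[OF assms(7)])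
qed

lemma tmap_tmap:
  assumes "module K A" "module K B" "module K V" "module K W" "module K V'" "module K W'"
    and "f \<in> linear_maps K A V" "g \<in> linear_maps K B W"
    and "f' \<in> linear_maps K V V'" "g' \<in> linear_maps K W W'"
    and "t \<in> carrier (tensor K A B)"
  shows "tmap K V' W' f' g' (tmap K V W f g t) = tmap K V' W' (\<lambda>x. f' (f x)) (\<lambda>x. g' (g x)) t"
  unfolding tmap_def[of K V' W']
  by (rule tlift_tmap[OF assms(1-4) module_tensor[OF assms(5,6)] assms(7,8)
        tmap_pure_bilinear[OF assms(5,6,9,10)] assms(11)])

lemma tmap_cong:
  assumes "module K A" "module K B" "module K V" "module K W"
    and "f \<in> linear_maps K A V" "g \<in> linear_maps K B W"
    and "\<And>a. a \<in> carrier A \<Longrightarrow> f' a = f a" "\<And>b. b \<in> carrier B \<Longrightarrow> g' b = g b"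
    and "t \<in> carrier (tensor K A B)"
  shows "tmap K V W f' g' t = tmap K V W f g t"
  unfolding tmap_def
  by (rule tlift_cong[OF assms(1,2) module_tensor[OF assms(3,4)] tmap_pure_bilinear[OF assms(3-6)] _ assms(9)])
    (simp add: assms(7,8))

lemma tmap_ident:
  assumes "module K A" "module K B" "t \<in> carrier (tensor K A B)"
  shows "tmap K A B (\<lambda>x. x) (\<lambda>x. x) t = t"
  unfolding tmap_def using tlift_tpure_self[OF assms] by simp

text \<open>By functoriality, a left inverse r of i gives the left inverse r \<otimes> r of i
  \<otimes> i.\<close>

lemma tmap_inj_on:
  assumes "module K A" "module K V" "i \<in> linear_maps K A V" "r \<in> linear_maps K V A"
    and "\<And>a. a \<in> carrier A \<Longrightarrow> r (i a) = a"
  shows "inj_on (tmap K V V i i) (carrier (tensor K A A))"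
proof (rule inj_on_inverseI)
  fix t assume t: "t \<in> carrier (tensor K A A)"
  have "tmap K A A r r (tmap K V V i i t) = tmap K A A (\<lambda>x. r (i x)) (\<lambda>x. r (i x)) t"
    by (rule tmap_tmap[OF assms(1,1,2,2,1,1,3,3,4,4) t])
  also have "\<dots> = tmap K A A (\<lambda>x. x) (\<lambda>x. x) t"
    by (rule tmap_cong[OF assms(1,1,1,1) linear_maps_ident linear_maps_ident assms(5) assms(5) t])
  finally show "tmap K A A r r (tmap K V V i i t) = t"
    by (simp add: tmap_ident[OF assms(1,1) t])
qed

section \<open>Complements of subspaces\<close>

text \<open>Two elements of the union lie in one member of the chain, the larger of the two they
  come from; nonemptiness supplies the zero vector.\<close>

lemma submodule_Union_chain:
  assumes "module K V" "\<C> \<noteq> {}" "subset.chain {W. submodule W K V} \<C>"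
  shows "submodule (\<Union>\<C>) K V"
proof -
  interpret V: module K V by fact
  have sm: "submodule W K V" if "W \<in> \<C>" for W
    using assms(3) that by (auto simp: subset.chain_def)
  have add: "x \<oplus>\<^bsub>V\<^esub> y \<in> \<Union>\<C>" if "x \<in> A" "A \<in> \<C>" "y \<in> B" "B \<in> \<C>" for x y A B
  proof -
    have "A \<subseteq> B \<or> B \<subseteq> A" using assms(3) that by (auto simp: subset_chain_def)
    then show ?thesis
    proof
      assume "A \<subseteq> B"
      then have "x \<oplus>\<^bsub>V\<^esub> y \<in> B" using that by (intro V.submoduleE(5)[OF sm]) auto
      then show ?thesis using that by blast
    next
      assume "B \<subseteq> A"
      then have "x \<oplus>\<^bsub>V\<^esub> y \<in> A" using that by (intro V.submoduleE(5)[OF sm]) auto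
      then show ?thesis using that by blast
    qed
  qed
  show ?thesis
  proof (rule V.submoduleI)
    show "\<Union>\<C> \<subseteq> carrier V" using V.submoduleE(1)[OF sm] by blast
    show "\<zero>\<^bsub>V\<^esub> \<in> \<Union>\<C>" using assms(2) submodule_zero[OF sm] by blast
    show "\<ominus>\<^bsub>V\<^esub> x \<in> \<Union>\<C>" if "x \<in> \<Union>\<C>" for x using that V.submoduleE(3)[OF sm] by blast
    show "x \<oplus>\<^bsub>V\<^esub> y \<in> \<Union>\<C>" if "x \<in> \<Union>\<C>" "y \<in> \<Union>\<C>" for x y using that add by blast
    show "a \<odot>\<^bsub>V\<^esub> x \<in> \<Union>\<C>" if "a \<in> carrier K" "x \<in> \<Union>\<C>" for a x
      using that V.submoduleE(4)[OF sm] by blast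
  qed
qed

text \<open>The sum of \<open>W\<close> and the multiples of \<open>v\<close>: the enlargement
  against which a maximal \<open>W\<close> is tested.\<close>

lemma submodule_adjoin:
  assumes "module K V" "submodule W K V" "v \<in> carrier V"
  shows "submodule {w \<oplus>\<^bsub>V\<^esub> a \<odot>\<^bsub>V\<^esub> v | w a. w \<in> W \<and> a \<in> carrier K} K V" (is "submodule ?S K V")
proof -
  interpret V: module K V by fact
  note W = V.submoduleE[OF assms(2)]
  have Wc: "w \<in> W \<Longrightarrow> w \<in> carrier V" for w using W(1) by blast
  show ?thesis
  proof (rule V.submoduleI)
    show "?S \<subseteq> carrier V" using assms(3) Wc by auto
    have "\<zero>\<^bsub>V\<^esub> = \<zero>\<^bsub>V\<^esub> \<oplus>\<^bsub>V\<^esub> \<zero>\<^bsub>K\<^esub> \<odot>\<^bsub>V\<^esub> v" using assms(3) by simp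
    then show "\<zero>\<^bsub>V\<^esub> \<in> ?S" using submodule_zero[OF assms(2)] V.R.zero_closed by blast
  next
    fix x assume "x \<in> ?S"
    then obtain w a where x: "x = w \<oplus>\<^bsub>V\<^esub> a \<odot>\<^bsub>V\<^esub> v" "w \<in> W" "a \<in> carrier K" by blast
    then have "\<ominus>\<^bsub>V\<^esub> x = \<ominus>\<^bsub>V\<^esub> w \<oplus>\<^bsub>V\<^esub> (\<ominus>\<^bsub>K\<^esub> a) \<odot>\<^bsub>V\<^esub> v"
      using assms(3) Wc by (simp add: V.M.minus_add V.smult_l_minus)
    then show "\<ominus>\<^bsub>V\<^esub> x \<in> ?S" using W(3) x V.R.a_inv_closed by blast
  next
    fix x y assume "x \<in> ?S" "y \<in> ?S"
    then obtain w a w' a' where x: "x = w \<oplus>\<^bsub>V\<^esub> a \<odot>\<^bsub>V\<^esub> v" "w \<in> W" "a \<in> carrier K"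
      and y: "y = w' \<oplus>\<^bsub>V\<^esub> a' \<odot>\<^bsub>V\<^esub> v" "w' \<in> W" "a' \<in> carrier K" by blast
    then have "x \<oplus>\<^bsub>V\<^esub> y = (w \<oplus>\<^bsub>V\<^esub> w') \<oplus>\<^bsub>V\<^esub> (a \<oplus>\<^bsub>K\<^esub> a') \<odot>\<^bsub>V\<^esub> v"
      using assms(3) Wc by (simp add: V.smult_l_distr V.M.a_ac)
    then show "x \<oplus>\<^bsub>V\<^esub> y \<in> ?S" using W(5) x y V.R.a_closed by blast
  next
    fix b x assume b: "b \<in> carrier K" and "x \<in> ?S"
    then obtain w a where x: "x = w \<oplus>\<^bsub>V\<^esub> a \<odot>\<^bsub>V\<^esub> v" "w \<in> W" "a \<in> carrier K" by blast
    then have "b \<odot>\<^bsub>V\<^esub> x = b \<odot>\<^bsub>V\<^esub> w \<oplus>\<^bsub>V\<^esub> (b \<otimes>\<^bsub>K\<^esub> a) \<odot>\<^bsub>V\<^esub> v"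
      using b assms(3) Wc by (simp add: V.smult_r_distr V.smult_assoc1)
    then show "b \<odot>\<^bsub>V\<^esub> x \<in> ?S" using W(4) x b V.R.m_closed by blast
  qed
qed

text \<open>A submodule maximal among those meeting \<open>X\<close> trivially is a complement. The
  spanning property is phrased as the existence of an \<open>X\<close>-component, the form from
  which a projection can be chosen.\<close>

lemma complement_exists:
  assumes "field K" "module K V" "submodule X K V"
  obtains W where "submodule W K V" "X \<inter> W = {\<zero>\<^bsub>V\<^esub>}"
    "\<And>v. v \<in> carrier V \<Longrightarrow> \<exists>x\<in>X. v \<ominus>\<^bsub>V\<^esub> x \<in> W"
proof -
  interpret V: module K V by fact
  interpret K: field K by fact
  note X = V.submoduleE[OF assms(3)]
  let ?A = "{W. submodule W K V \<and> X \<inter> W = {\<zero>\<^bsub>V\<^esub>}}"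
  have "{\<zero>\<^bsub>V\<^esub>} \<in> ?A"
    using submodule_singleton_zero[OF assms(2)] submodule_zero[OF assms(3)] by auto
  moreover have "\<Union>\<C> \<in> ?A" if "\<C> \<noteq> {}" "subset.chain ?A \<C>" for \<C>
  proof -
    have "subset.chain {W. submodule W K V} \<C>" using that(2) by (auto simp: subset_chain_def)
    then have "submodule (\<Union>\<C>) K V" using submodule_Union_chain[OF assms(2) that(1)] by blast
    moreover have "X \<inter> \<Union>\<C> = {\<zero>\<^bsub>V\<^esub>}" using that unfolding subset_chain_def by blast
    ultimately show ?thesis by blast
  qed
  ultimately have "\<exists>W\<in>?A. \<forall>W'\<in>?A. W \<subseteq> W' \<longrightarrow> W' = W"
    by (intro subset_Zorn_nonempty) auto
  then obtain W where WA: "W \<in> ?A" and "\<forall>W'\<in>?A. W \<subseteq> W' \<longrightarrow> W' = W"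
    by (rule bexE)
  then have max: "W' = W" if "submodule W' K V" "X \<inter> W' = {\<zero>\<^bsub>V\<^esub>}" "W \<subseteq> W'" for W'
    using that by simp
  have W: "submodule W K V" "X \<inter> W = {\<zero>\<^bsub>V\<^esub>}" using WA by simp_all
  note Wsub = V.submoduleE[OF W(1)]
  have "\<exists>x\<in>X. v \<ominus>\<^bsub>V\<^esub> x \<in> W" if v: "v \<in> carrier V" for v
  proof (rule ccontr)
    assume neg: "\<not> ?thesis"
    let ?S = "{w \<oplus>\<^bsub>V\<^esub> a \<odot>\<^bsub>V\<^esub> v | w a. w \<in> W \<and> a \<in> carrier K}"
    have S: "submodule ?S K V" by (rule submodule_adjoin[OF assms(2) W(1) v])
    \<comment> \<open>If \<open>w\<close> plus a nonzero multiple of \<open>v\<close> lay in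
      \<open>X\<close>, dividing by the coefficient would give an element of \<open>X\<close> that
      differs from \<open>v\<close> by an element of \<open>W\<close>, contrary to
      \<open>neg\<close>. Invertibility of nonzero scalars enters here.\<close>
    have a0: "a = \<zero>\<^bsub>K\<^esub>" if "w \<in> W" "a \<in> carrier K" "w \<oplus>\<^bsub>V\<^esub> a \<odot>\<^bsub>V\<^esub> v \<in> X" for w a
    proof (rule ccontr)
      assume "a \<noteq> \<zero>\<^bsub>K\<^esub>"
      then have a: "inv\<^bsub>K\<^esub> a \<in> carrier K" "inv\<^bsub>K\<^esub> a \<otimes>\<^bsub>K\<^esub> a = \<one>\<^bsub>K\<^esub>"
        using that K.field_Units by (auto intro: V.R.Units_l_inv V.R.Units_inv_closed)
      have wc: "w \<in> carrier V" using that Wsub(1) by blast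
      let ?x = "inv\<^bsub>K\<^esub> a \<odot>\<^bsub>V\<^esub> (w \<oplus>\<^bsub>V\<^esub> a \<odot>\<^bsub>V\<^esub> v)"
      have "?x = inv\<^bsub>K\<^esub> a \<odot>\<^bsub>V\<^esub> w \<oplus>\<^bsub>V\<^esub> v"
        using a that(2) wc v by (simp add: V.smult_r_distr V.smult_assoc1[symmetric])
      then have "v \<ominus>\<^bsub>V\<^esub> ?x = \<ominus>\<^bsub>V\<^esub> (inv\<^bsub>K\<^esub> a \<odot>\<^bsub>V\<^esub> w)"
        using a wc v by (simp add: a_minus_def V.M.minus_add V.M.a_lcomm[of v] V.M.r_neg)
      also have "\<dots> \<in> W" using Wsub(3,4) a that by blast
      finally show False using neg X(4)[OF a(1) that(3)] by blast
    qed
    have "X \<inter> ?S = {\<zero>\<^bsub>V\<^esub>}"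
    proof (intro equalityI subsetI)
      fix x assume "x \<in> X \<inter> ?S"
      then obtain w a where x: "x = w \<oplus>\<^bsub>V\<^esub> a \<odot>\<^bsub>V\<^esub> v" "w \<in> W" "a \<in> carrier K" "x \<in> X" by blast
      with a0 have "a = \<zero>\<^bsub>K\<^esub>" by blast
      with x v Wsub(1) have "x = w" by auto
      with x(2,4) have "x \<in> X \<inter> W" by simp
      then show "x \<in> {\<zero>\<^bsub>V\<^esub>}" by (simp only: W(2))
    next
      fix x assume "x \<in> {\<zero>\<^bsub>V\<^esub>}"
      then show "x \<in> X \<inter> ?S"
        using submodule_zero[OF S] submodule_zero[OF assms(3)] by (simp only: singleton_iff Int_iff)
    qed
    moreover have "W \<subseteq> ?S"
    proof
      fix w assume w: "w \<in> W"
      then have "w = w \<oplus>\<^bsub>V\<^esub> \<zero>\<^bsub>K\<^esub> \<odot>\<^bsub>V\<^esub> v" using v Wsub(1) by auto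
      then show "w \<in> ?S" using w V.R.zero_closed by blast
    qed
    \<comment> \<open>Maximality forces \<open>v\<close> into \<open>W\<close>, and then zero is an
      \<open>X\<close>-component of \<open>v\<close> after all.\<close>
    ultimately have "?S = W" using max[OF S] by blast
    moreover have "v = \<zero>\<^bsub>V\<^esub> \<oplus>\<^bsub>V\<^esub> \<one>\<^bsub>K\<^esub> \<odot>\<^bsub>V\<^esub> v" using v by simp
    ultimately have "v \<in> W" using submodule_zero[OF W(1)] V.R.one_closed by blast
    moreover have "v \<ominus>\<^bsub>V\<^esub> \<zero>\<^bsub>V\<^esub> = v" using v by (simp add: a_minus_def)
    ultimately show False using neg submodule_zero[OF assms(3)] by (metis (no_types))
  qed
  with W show ?thesis by (rule that)
qed

text \<open>Projection along a complement. Components in \<open>X\<close> are unique, because the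
  difference of two of them lies in both \<open>X\<close> and \<open>W\<close>; for linearity of
  \<open>r\<close> it is then enough that sums and multiples of components are again
  components.\<close>

lemma retraction_exists:
  assumes "field K" "module K V" "submodule X K V"
  obtains r where "r \<in> linear_maps K V V" "r ` carrier V \<subseteq> X" "\<And>x. x \<in> X \<Longrightarrow> r x = x"
proof -
  interpret V: module K V by fact
  obtain W where W: "submodule W K V" "X \<inter> W = {\<zero>\<^bsub>V\<^esub>}"
    and ex: "\<And>v. v \<in> carrier V \<Longrightarrow> \<exists>x\<in>X. v \<ominus>\<^bsub>V\<^esub> x \<in> W"
    using complement_exists[OF assms] by blast
  note X = V.submoduleE[OF assms(3)] and Wsub = V.submoduleE[OF W(1)]
  have Xc: "x \<in> X \<Longrightarrow> x \<in> carrier V" for x using X(1) by blast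
  have uniq: "x = y" if "x \<in> X" "y \<in> X" "v \<ominus>\<^bsub>V\<^esub> x \<in> W" "v \<ominus>\<^bsub>V\<^esub> y \<in> W" "v \<in> carrier V" for v x y
  proof -
    have "(v \<ominus>\<^bsub>V\<^esub> x) \<ominus>\<^bsub>V\<^esub> (v \<ominus>\<^bsub>V\<^esub> y) \<in> W"
      by (rule submodule_minus[OF assms(2) W(1) that(3,4)])
    also have "(v \<ominus>\<^bsub>V\<^esub> x) \<ominus>\<^bsub>V\<^esub> (v \<ominus>\<^bsub>V\<^esub> y) = y \<ominus>\<^bsub>V\<^esub> x"
      using that Xc by (simp add: a_minus_def V.M.minus_add V.M.a_ac V.M.r_neg1 V.M.r_neg2 V.M.r_neg)
    finally have "y \<ominus>\<^bsub>V\<^esub> x \<in> X \<inter> W" using submodule_minus[OF assms(2,3)] that by blast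
    then have "y \<ominus>\<^bsub>V\<^esub> x = \<zero>\<^bsub>V\<^esub>" using W(2) by blast
    moreover have "y = (y \<ominus>\<^bsub>V\<^esub> x) \<oplus>\<^bsub>V\<^esub> x"
      using that Xc by (simp add: a_minus_def V.M.a_assoc V.M.l_neg)
    ultimately show ?thesis using that Xc by simp
  qed
  define r where "r v = (SOME x. x \<in> X \<and> v \<ominus>\<^bsub>V\<^esub> x \<in> W)" for v
  have r: "r v \<in> X" "v \<ominus>\<^bsub>V\<^esub> r v \<in> W" if "v \<in> carrier V" for v
    using someI_ex[of "\<lambda>x. x \<in> X \<and> v \<ominus>\<^bsub>V\<^esub> x \<in> W"] ex[OF that] unfolding r_def by blast+
  show ?thesis
  proof
    show "r \<in> linear_maps K V V"
    proof (rule linear_mapsI)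
      fix v assume "v \<in> carrier V"
      then show "r v \<in> carrier V" using r Xc by blast
    next
      fix u v assume uv: "u \<in> carrier V" "v \<in> carrier V"
      have "(u \<ominus>\<^bsub>V\<^esub> r u) \<oplus>\<^bsub>V\<^esub> (v \<ominus>\<^bsub>V\<^esub> r v) \<in> W" using Wsub(5) r uv by blast
      also have "(u \<ominus>\<^bsub>V\<^esub> r u) \<oplus>\<^bsub>V\<^esub> (v \<ominus>\<^bsub>V\<^esub> r v) = (u \<oplus>\<^bsub>V\<^esub> v) \<ominus>\<^bsub>V\<^esub> (r u \<oplus>\<^bsub>V\<^esub> r v)"
        using uv Xc r by (simp add: a_minus_def V.M.minus_add V.M.a_ac)
      finally show "r (u \<oplus>\<^bsub>V\<^esub> v) = r u \<oplus>\<^bsub>V\<^esub> r v"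
        using uv r X(5) by (intro uniq[of _ _ "u \<oplus>\<^bsub>V\<^esub> v"]) auto
    next
      fix a v assume av: "a \<in> carrier K" "v \<in> carrier V"
      have "a \<odot>\<^bsub>V\<^esub> (v \<ominus>\<^bsub>V\<^esub> r v) \<in> W" using Wsub(4) r av by blast
      also have "a \<odot>\<^bsub>V\<^esub> (v \<ominus>\<^bsub>V\<^esub> r v) = a \<odot>\<^bsub>V\<^esub> v \<ominus>\<^bsub>V\<^esub> a \<odot>\<^bsub>V\<^esub> r v"
        using av Xc r by (simp add: a_minus_def V.smult_r_distr V.smult_r_minus)
      finally show "r (a \<odot>\<^bsub>V\<^esub> v) = a \<odot>\<^bsub>V\<^esub> r v"
        using av r X(4) by (intro uniq[of _ _ "a \<odot>\<^bsub>V\<^esub> v"]) auto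
    qed
    show "r ` carrier V \<subseteq> X" using r by blast
    show "r x = x" if "x \<in> X" for x
      using that Xc r submodule_zero[OF W(1)]
      by (intro uniq[of _ _ x]) (auto simp: a_minus_def V.M.r_neg)
  qed
qed

section \<open>Subcoalgebras\<close>

lemma module_sub_coalg:
  assumes "module K D" "submodule X K D"
  shows "module K (sub_coalg K D X)"
proof -
  interpret X: module K "D\<lparr>carrier := X\<rparr>"
    by (rule submodule.submodule_is_module[OF assms(2,1)])
  have "abelian_group (sub_coalg K D X)"
    using X.M.a_comm_group X.M.a_comm_monoid
    by (intro abelian_group.intro abelian_monoid.intro abelian_group_axioms.intro)
      (simp_all add: sub_coalg_def)
  then show ?thesis
    using X.smult_closed X.smult_l_distr X.smult_r_distr X.smult_assoc1 X.smult_one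
    by (intro moduleI X.R.is_cring) (simp_all add: sub_coalg_def)
qed

lemma sub_coalg_simps [simp]:
  "carrier (sub_coalg K D X) = X"
  "add (sub_coalg K D X) = add D"
  "zero (sub_coalg K D X) = zero D"
  "smult (sub_coalg K D X) = smult D"
  "counit (sub_coalg K D X) = counit D"
  by (simp_all add: sub_coalg_def)

text \<open>\<open>subcoalgebra\<close> and \<open>sub_coalg\<close> work with two records that can
  differ only in the field \<open>comult\<close>; a tensor product reads the module fields alone, so
  the tensor squares coincide.\<close>

lemma tensor_sub_coalg:
  "tensor K (D\<lparr>carrier := X\<rparr>) (D\<lparr>carrier := X\<rparr>) = tensor K (sub_coalg K D X) (sub_coalg K D X)"
  by (simp add: tensor_def tensor_null_def bilinear_rels_def)

lemma comult_sub_coalg_The: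
  "comult (sub_coalg K D X) x = (THE t. t \<in> carrier (tensor K (sub_coalg K D X) (sub_coalg K D X)) \<and>
    tmap K D D (\<lambda>x. x) (\<lambda>x. x) t = comult D x)"
  by (subst sub_coalg_def) (simp add: tensor_sub_coalg)

lemma subcoalgebra_iff:
  "subcoalgebra K X D \<longleftrightarrow> submodule X K D \<and> (\<forall>x\<in>X. comult D x \<in>
    tmap K D D (\<lambda>x. x) (\<lambda>x. x) ` carrier (tensor K (sub_coalg K D X) (sub_coalg K D X)))"
  by (simp add: subcoalgebra_def tensor_sub_coalg)

lemma sub_coalg_incl_linear:
  assumes "X \<subseteq> carrier D"
  shows "(\<lambda>x. x) \<in> linear_maps K (sub_coalg K D X) D"
  using assms by (auto intro!: linear_mapsI)

lemma linear_maps_sub_coalg: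
  assumes "f \<in> linear_maps K C D" "f ` carrier C \<subseteq> X"
  shows "f \<in> linear_maps K C (sub_coalg K D X)"
  using assms
  by (intro linear_mapsI) (auto simp: linear_maps_add[OF assms(1)] linear_maps_smult[OF assms(1)])

lemma tensor_sub_coalg_inj_on:
  assumes "field K" "module K D" "submodule X K D"
  shows "inj_on (tmap K D D (\<lambda>x. x) (\<lambda>x. x)) (carrier (tensor K (sub_coalg K D X) (sub_coalg K D X)))"
proof -
  obtain r where r: "r \<in> linear_maps K D D" "r ` carrier D \<subseteq> X" "\<And>x. x \<in> X \<Longrightarrow> r x = x"
    using retraction_exists[OF assms] by blast
  show ?thesis
    by (rule tmap_inj_on[OF module_sub_coalg[OF assms(2,3)] assms(2) sub_coalg_incl_linear
          linear_maps_sub_coalg[OF r(1,2)]])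
      (use module.submoduleE(1)[OF assms(2,3)] r(3) in auto)
qed

section \<open>Restriction of the comultiplication to a subcoalgebra\<close>

context
  fixes K :: "('k, 'p) ring_scheme" and D :: "('k, 'd) coalgebra" and X :: "'d set"
  assumes field_K: "field K" and mod_D: "module K D"
    and comult_D: "comult D \<in> linear_maps K D (tensor K D D)"
    and subc: "subcoalgebra K X D"
begin

abbreviation (input) "B \<equiv> sub_coalg K D X"

lemma subcoalgebra_submodule: "submodule X K D"
  using subc by (simp add: subcoalgebra_def)

lemma subcoalgebra_subset: "X \<subseteq> carrier D"
  by (rule module.submoduleE(1)[OF mod_D subcoalgebra_submodule])

lemmas sub_module = module_sub_coalg[OF mod_D subcoalgebra_submodule]
lemmas sub_incl = sub_coalg_incl_linear[OF subcoalgebra_subset]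
lemmas sub_incl_tensor_linear = tmap_linear[OF sub_module sub_module mod_D mod_D sub_incl sub_incl]
lemmas sub_inj = tensor_sub_coalg_inj_on[OF field_K mod_D subcoalgebra_submodule]

text \<open>The \<open>THE\<close> in \<open>sub_coalg\<close> is well defined: being a subcoalgebra
  gives existence, injectivity on the tensor square gives uniqueness.\<close>

lemma comult_sub_coalg:
  assumes "x \<in> X"
  shows "comult B x \<in> carrier (tensor K B B)"
    and "tmap K D D (\<lambda>x. x) (\<lambda>x. x) (comult B x) = comult D x"
proof -
  obtain t where t: "t \<in> carrier (tensor K B B)" "comult D x = tmap K D D (\<lambda>x. x) (\<lambda>x. x) t"
    using subc assms by (auto simp: subcoalgebra_iff)
  have "\<exists>!t. t \<in> carrier (tensor K B B) \<and> tmap K D D (\<lambda>x. x) (\<lambda>x. x) t = comult D x"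
  proof (rule ex1I[of _ t])
    fix s assume "s \<in> carrier (tensor K B B) \<and> tmap K D D (\<lambda>x. x) (\<lambda>x. x) s = comult D x"
    then have s: "s \<in> carrier (tensor K B B)" "tmap K D D (\<lambda>x. x) (\<lambda>x. x) s = comult D x" by blast+
    show "s = t" by (rule inj_onD[OF sub_inj trans[OF s(2) t(2)] s(1) t(1)])
  qed (simp add: t)
  from theI'[OF this, folded comult_sub_coalg_The]
  show "comult B x \<in> carrier (tensor K B B)"
    and "tmap K D D (\<lambda>x. x) (\<lambda>x. x) (comult B x) = comult D x"
    by blast+
qed

text \<open>The way to compute the restricted comultiplication: a candidate in the small tensor
  square is right once its image in D \<otimes> D is.\<close>

lemma comult_sub_coalg_eqI:
  assumes "x \<in> X" "t \<in> carrier (tensor K B B)" "tmap K D D (\<lambda>x. x) (\<lambda>x. x) t = comult D x"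
  shows "comult B x = t"
  using inj_onD[OF sub_inj] comult_sub_coalg[OF assms(1)] assms(2,3) by metis

lemma comult_sub_coalg_linear: "comult B \<in> linear_maps K B (tensor K B B)"
proof -
  interpret T: module K "tensor K B B" by (rule module_tensor[OF sub_module sub_module])
  note X = module.submoduleE[OF mod_D subcoalgebra_submodule]
  have Xc: "x \<in> X \<Longrightarrow> x \<in> carrier D" for x using X(1) by blast
  note simps = comult_sub_coalg linear_maps_add[OF comult_D] linear_maps_smult[OF comult_D] Xc
    linear_maps_add[OF sub_incl_tensor_linear] linear_maps_smult[OF sub_incl_tensor_linear]
  show ?thesis
  proof (rule linear_mapsI)
    fix x y assume xy: "x \<in> carrier B" "y \<in> carrier B"
    then have "comult B (x \<oplus>\<^bsub>D\<^esub> y) = comult B x \<oplus>\<^bsub>tensor K B B\<^esub> comult B y"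
      using X(5) by (intro comult_sub_coalg_eqI) (simp_all add: simps)
    then show "comult B (x \<oplus>\<^bsub>B\<^esub> y) = comult B x \<oplus>\<^bsub>tensor K B B\<^esub> comult B y" by simp
  next
    fix a x assume ax: "a \<in> carrier K" "x \<in> carrier B"
    then have "comult B (a \<odot>\<^bsub>D\<^esub> x) = a \<odot>\<^bsub>tensor K B B\<^esub> comult B x"
      using X(4) by (intro comult_sub_coalg_eqI) (simp_all add: simps)
    then show "comult B (a \<odot>\<^bsub>B\<^esub> x) = a \<odot>\<^bsub>tensor K B B\<^esub> comult B x" by simp
  qed (simp add: comult_sub_coalg)
qed

text \<open>Corestriction. Applying \<open>f\<close> to both factors inside the small tensor square
  gives a candidate whose image in D \<otimes> D is \<open>comult D (f c)\<close>, so injectivity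
  identifies it with the restricted comultiplication.\<close>

lemma coalg_hom_sub_coalgI:
  assumes "module K C" "comult C \<in> linear_maps K C (tensor K C C)"
    and "f \<in> coalg_hom K C D" "f ` carrier C \<subseteq> X"
  shows "f \<in> coalg_hom K C B"
proof -
  have lin: "f \<in> linear_maps K C D" using assms(3) by (simp add: coalg_hom_def)
  have linB: "f \<in> linear_maps K C B" by (rule linear_maps_sub_coalg[OF lin assms(4)])
  have "comult B (f c) = tmap K B B f f (comult C c)" if c: "c \<in> carrier C" for c
  proof (rule comult_sub_coalg_eqI)
    have cc: "comult C c \<in> carrier (tensor K C C)" by (rule linear_maps_closed[OF assms(2) c])
    show "f c \<in> X" using assms(4) c by auto
    show "tmap K B B f f (comult C c) \<in> carrier (tensor K B B)"
      by (rule linear_maps_closed[OF tmap_linear[OF assms(1,1) sub_module sub_module linB linB] cc])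
    have "tmap K D D (\<lambda>x. x) (\<lambda>x. x) (tmap K B B f f (comult C c)) = tmap K D D f f (comult C c)"
      by (rule tmap_tmap[OF assms(1,1) sub_module sub_module mod_D mod_D linB linB sub_incl sub_incl cc])
    then show "tmap K D D (\<lambda>x. x) (\<lambda>x. x) (tmap K B B f f (comult C c)) = comult D (f c)"
      using assms(3) c by (simp add: coalg_hom_def)
  qed
  then show ?thesis using assms(3) linB by (simp add: coalg_hom_def)
qed

text \<open>Composition with the inclusion. It turns a competitor with values in the subcoalgebra
  into one with values in \<open>D\<close>, which is how uniqueness in the cofree coalgebra is
  brought to bear.\<close>

lemma coalg_hom_sub_coalgD:
  assumes "module K C" "comult C \<in> linear_maps K C (tensor K C C)" "f \<in> coalg_hom K C B"
  shows "f \<in> coalg_hom K C D"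
proof -
  have lin: "f \<in> linear_maps K C B" using assms(3) by (simp add: coalg_hom_def)
  have "comult D (f c) = tmap K D D f f (comult C c)" if c: "c \<in> carrier C" for c
  proof -
    have cc: "comult C c \<in> carrier (tensor K C C)" by (rule linear_maps_closed[OF assms(2) c])
    have "f c \<in> X" using linear_maps_closed[OF lin c] by simp
    then have "comult D (f c) = tmap K D D (\<lambda>x. x) (\<lambda>x. x) (comult B (f c))"
      by (simp add: comult_sub_coalg)
    also have "\<dots> = tmap K D D (\<lambda>x. x) (\<lambda>x. x) (tmap K B B f f (comult C c))"
      using assms(3) c by (simp add: coalg_hom_def)
    also have "\<dots> = tmap K D D f f (comult C c)"
      by (rule tmap_tmap[OF assms(1,1) sub_module sub_module mod_D mod_D lin lin sub_incl sub_incl cc])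
    finally show ?thesis .
  qed
  moreover have "f \<in> linear_maps K C D"
    using linear_maps_comp[OF lin sub_incl] .
  ultimately show ?thesis using assms(3) by (simp add: coalg_hom_def)
qed

end

text \<open>The required preimage of \<open>comult D (f c)\<close> is (f \<otimes> f) applied to
  \<open>comult C c\<close>, formed with the image itself as codomain of \<open>f\<close>.\<close>

lemma coalg_hom_image_subcoalgebra:
  assumes "module K C" "comult C \<in> linear_maps K C (tensor K C C)" "module K D"
    and "f \<in> coalg_hom K C D"
  shows "subcoalgebra K (f ` carrier C) D"
proof -
  let ?B = "sub_coalg K D (f ` carrier C)"
  have lin: "f \<in> linear_maps K C D" using assms(4) by (simp add: coalg_hom_def)
  have sub: "submodule (f ` carrier C) K D" by (rule submodule_image[OF lin assms(1,3)])
  have linB: "f \<in> linear_maps K C ?B" by (rule linear_maps_sub_coalg[OF lin]) simp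
  note B = module_sub_coalg[OF assms(3) sub]
  note incl = sub_coalg_incl_linear[OF module.submoduleE(1)[OF assms(3) sub]]
  have "comult D (f c) \<in> tmap K D D (\<lambda>x. x) (\<lambda>x. x) ` carrier (tensor K ?B ?B)"
    if c: "c \<in> carrier C" for c
  proof -
    have cc: "comult C c \<in> carrier (tensor K C C)" by (rule linear_maps_closed[OF assms(2) c])
    have "tmap K ?B ?B f f (comult C c) \<in> carrier (tensor K ?B ?B)"
      by (rule linear_maps_closed[OF tmap_linear[OF assms(1,1) B B linB linB] cc])
    moreover have "tmap K D D (\<lambda>x. x) (\<lambda>x. x) (tmap K ?B ?B f f (comult C c)) = tmap K D D f f (comult C c)"
      by (rule tmap_tmap[OF assms(1,1) B B assms(3,3) linB linB incl incl cc])
    ultimately show ?thesis using assms(4) c by (force simp: coalg_hom_def)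
  qed
  with sub show ?thesis by (auto simp: subcoalgebra_iff)
qed

text \<open>The elements whose comultiplication comes from the tensor square of the span form a
  submodule, so it is enough that this submodule contains each \<open>X\<close>. There, a tensor
  over \<open>X\<close> is pushed forward along the inclusion of \<open>X\<close> into the
  span.\<close>

lemma subcoalgebra_span:
  assumes "module K D" "comult D \<in> linear_maps K D (tensor K D D)"
    and "\<And>X. X \<in> \<X> \<Longrightarrow> subcoalgebra K X D"
  shows "subcoalgebra K (module_span K D (\<Union>\<X>)) D"
proof -
  let ?P = "module_span K D (\<Union>\<X>)" let ?B = "sub_coalg K D ?P"
  have subX: "submodule X K D" if "X \<in> \<X>" for X using assms(3)[OF that] by (simp add: subcoalgebra_def)
  have "\<Union>\<X> \<subseteq> carrier D" using module.submoduleE(1)[OF assms(1) subX] by blast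
  then have P: "submodule ?P K D" by (rule module_span_submodule[OF assms(1)])
  note B = module_sub_coalg[OF assms(1) P]
  note PD = module.submoduleE(1)[OF assms(1) P]
  note inclP = sub_coalg_incl_linear[OF PD]
  let ?I = "tmap K D D (\<lambda>x. x) (\<lambda>x. x) ` carrier (tensor K ?B ?B)"
  have I: "submodule ?I K (tensor K D D)"
    by (rule submodule_image[OF tmap_linear[OF B B assms(1,1) inclP inclP]
          module_tensor[OF B B] module_tensor[OF assms(1,1)]])
  have "X \<subseteq> {x \<in> carrier D. comult D x \<in> ?I}" if X: "X \<in> \<X>" for X
  proof
    fix x assume x: "x \<in> X"
    let ?A = "sub_coalg K D X"
    note A = module_sub_coalg[OF assms(1) subX[OF X]]
    have XP: "X \<subseteq> ?P" using module_span_superset[of "\<Union>\<X>" K D] X by blast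
    have incl: "(\<lambda>x. x) \<in> linear_maps K ?A ?B"
      using XP by (auto intro!: linear_mapsI)
    obtain t where t: "t \<in> carrier (tensor K ?A ?A)" "comult D x = tmap K D D (\<lambda>x. x) (\<lambda>x. x) t"
      using assms(3)[OF X] x by (auto simp: subcoalgebra_iff)
    have "tmap K ?B ?B (\<lambda>x. x) (\<lambda>x. x) t \<in> carrier (tensor K ?B ?B)"
      by (rule linear_maps_closed[OF tmap_linear[OF A A B B incl incl] t(1)])
    moreover have "tmap K D D (\<lambda>x. x) (\<lambda>x. x) (tmap K ?B ?B (\<lambda>x. x) (\<lambda>x. x) t) = comult D x"
      unfolding t(2) by (rule tmap_tmap[OF A A B B assms(1,1) incl incl inclP inclP t(1)])
    ultimately have "comult D x \<in> ?I" by (metis imageI)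
    then show "x \<in> {x \<in> carrier D. comult D x \<in> ?I}" using x XP PD by blast
  qed
  then have "?P \<subseteq> {x \<in> carrier D. comult D x \<in> ?I}"
    by (intro module_span_least submodule_vimage[OF assms(2,1) module_tensor[OF assms(1,1)] I]) blast
  then show ?thesis using P by (auto simp: subcoalgebra_iff)
qed

section \<open>Partial corepresentations\<close>

lemma coalgebra_facts:
  assumes "coalgebra K C"
  shows "field K" "module K C" "comult C \<in> linear_maps K C (tensor K C C)"
  using assms by (auto simp: coalgebra_def coalgebra_axioms_def)

text \<open>Transfers a Sweedler sum along a coalgebra map. The integrand \<open>b'\<close> is tied
  to \<open>b\<close> on the carrier only, since relations such as
  \<open>p (g c) = \<omega> c\<close> are available only there.\<close>

lemma tlift_comult_coalg_hom:
  assumes "module K C" "comult C \<in> linear_maps K C (tensor K C C)" "module K D" "module K U"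
    and "g \<in> coalg_hom K C D" "b \<in> bilinear_maps K D D U"
    and "\<And>x y. x \<in> carrier C \<Longrightarrow> y \<in> carrier C \<Longrightarrow> b' x y = b (g x) (g y)"
    and "c \<in> carrier C"
  shows "tlift K U b (comult D (g c)) = tlift K U b' (comult C c)"
proof -
  have g: "g \<in> linear_maps K C D" using assms(5) by (simp add: coalg_hom_def)
  have c: "comult C c \<in> carrier (tensor K C C)" by (rule linear_maps_closed[OF assms(2,8)])
  have "tlift K U b (comult D (g c)) = tlift K U b (tmap K D D g g (comult C c))"
    using assms(5,8) by (simp add: coalg_hom_def)
  also have "\<dots> = tlift K U (\<lambda>x y. b (g x) (g y)) (comult C c)"
    by (rule tlift_tmap[OF assms(1,1,3,3,4) g g assms(6) c])
  also have "\<dots> = tlift K U b' (comult C c)"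
    by (rule tlift_cong[OF assms(1,1,4) bilinear_maps_comp[OF assms(6) g g] assms(7) c, symmetric])
  finally show ?thesis .
qed

section \<open>Partial corepresentations of a fixed Hopf algebra\<close>

context
  fixes K :: "('k, 'p) ring_scheme" and H :: "('k, 'h) coalgebra" and S :: "'h \<Rightarrow> 'h"
  assumes hopf: "hopf_algebra K H S"
begin

interpretation hopf_algebra K H S by (rule hopf)

lemma mod_H: "module K H" by (rule module_axioms)

lemmas mod_HH = module_tensor[OF mod_H mod_H]

abbreviation (input) "HH \<equiv> tensor K H H"

lemma mult_bilinear: "(\<lambda>x y. x \<otimes>\<^bsub>H\<^esub> y) \<in> bilinear_maps K H H H"
  by (intro bilinear_mapsI linear_mapsI)
    (auto simp: H.l_distr H.r_distr smult_mult_left smult_mult_right)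

text \<open>Linearity of x \<otimes> y S(z) in its three variables, split into a bilinear map and a
  linear parameter as \<open>tlift_bilinear_param\<close> expects.\<close>

lemma corep_left_trilinear:
  "z \<in> carrier H \<Longrightarrow> (\<lambda>x y. tpure K H H x (y \<otimes>\<^bsub>H\<^esub> S z)) \<in> bilinear_maps K H H HH"
  "x \<in> carrier H \<Longrightarrow> y \<in> carrier H \<Longrightarrow> (\<lambda>z. tpure K H H x (y \<otimes>\<^bsub>H\<^esub> S z)) \<in> linear_maps K H HH"
proof -
  assume z: "z \<in> carrier H"
  show "(\<lambda>x y. tpure K H H x (y \<otimes>\<^bsub>H\<^esub> S z)) \<in> bilinear_maps K H H HH"
    by (rule bilinear_maps_comp[OF tpure_bilinear[OF mod_H mod_H] linear_maps_ident
          bilinear_mapsD(2)[OF mult_bilinear linear_maps_closed[OF antipode_linear z]]])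
next
  assume "x \<in> carrier H" "y \<in> carrier H"
  then show "(\<lambda>z. tpure K H H x (y \<otimes>\<^bsub>H\<^esub> S z)) \<in> linear_maps K H HH"
    by (intro linear_maps_comp[OF linear_maps_comp[OF antipode_linear bilinear_mapsD(1)[OF mult_bilinear]]
          bilinear_mapsD(1)[OF tpure_bilinear[OF mod_H mod_H]]])
qed

text \<open>The expression x S(y) \<otimes> z of the second identity occurs with two bracketings: on
  the left-hand side the last two variables come from one comultiplication, on the right-hand side
  the first two. Each bracketing needs its own pair of bilinear map and linear parameter.\<close>

lemma corep_right_trilinear:
  "z \<in> carrier H \<Longrightarrow> (\<lambda>x y. tpure K H H (z \<otimes>\<^bsub>H\<^esub> S x) y) \<in> bilinear_maps K H H HH"
  "z \<in> carrier H \<Longrightarrow> (\<lambda>x y. tpure K H H (x \<otimes>\<^bsub>H\<^esub> S y) z) \<in> bilinear_maps K H H HH"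
  "x \<in> carrier H \<Longrightarrow> y \<in> carrier H \<Longrightarrow> (\<lambda>z. tpure K H H (z \<otimes>\<^bsub>H\<^esub> S x) y) \<in> linear_maps K H HH"
  "x \<in> carrier H \<Longrightarrow> y \<in> carrier H \<Longrightarrow> (\<lambda>z. tpure K H H (x \<otimes>\<^bsub>H\<^esub> S y) z) \<in> linear_maps K H HH"
proof -
  assume z: "z \<in> carrier H"
  show "(\<lambda>x y. tpure K H H (z \<otimes>\<^bsub>H\<^esub> S x) y) \<in> bilinear_maps K H H HH"
    by (rule bilinear_maps_comp[OF tpure_bilinear[OF mod_H mod_H]
          linear_maps_comp[OF antipode_linear bilinear_mapsD(1)[OF mult_bilinear z]] linear_maps_ident])
  show "(\<lambda>x y. tpure K H H (x \<otimes>\<^bsub>H\<^esub> S y) z) \<in> bilinear_maps K H H HH"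
    by (rule linear_comp_bilinear[OF bilinear_maps_comp[OF mult_bilinear linear_maps_ident antipode_linear]
          bilinear_mapsD(2)[OF tpure_bilinear[OF mod_H mod_H] z]])
next
  assume xy: "x \<in> carrier H" "y \<in> carrier H"
  note S = linear_maps_closed[OF antipode_linear]
  show "(\<lambda>z. tpure K H H (z \<otimes>\<^bsub>H\<^esub> S x) y) \<in> linear_maps K H HH"
    by (rule linear_maps_comp[OF bilinear_mapsD(2)[OF mult_bilinear S[OF xy(1)]]
          bilinear_mapsD(2)[OF tpure_bilinear[OF mod_H mod_H] xy(2)]])
  show "(\<lambda>z. tpure K H H (x \<otimes>\<^bsub>H\<^esub> S y) z) \<in> linear_maps K H HH"
    using xy S by (intro bilinear_mapsD(1)[OF tpure_bilinear[OF mod_H mod_H]]) auto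
qed

text \<open>For the identity map both sides of the first condition are the same term. The two sides
  of the second bracket the iterated comultiplication oppositely, and the condition is
  coassociativity followed by the contraction x \<otimes> (y \<otimes> z) \<mapsto> x S(y) \<otimes>
  z.\<close>

lemma partial_corep_ident: "partial_corep K H S H (\<lambda>h. h)"
proof -
  let ?H3 = "tensor K H HH"
  note mod_H3 = module_tensor[OF mod_H mod_HH]
  note tp = tpure_bilinear[OF mod_H mod_H] and tp3 = tpure_bilinear[OF mod_H mod_HH]
  \<comment> \<open>\<open>?\<Phi>'\<close> is the contraction with its first argument kept apart;
    \<open>?\<Phi>\<close> is its linear extension to H \<otimes> (H \<otimes> H).\<close>
  let ?\<Phi>' = "\<lambda>x u. tlift K HH (\<lambda>y z. tpure K H H (x \<otimes>\<^bsub>H\<^esub> S y) z) u"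
  let ?\<Phi> = "tlift K HH ?\<Phi>'"
  have bil: "?\<Phi>' \<in> bilinear_maps K H HH HH"
    by (rule tlift_bilinear_param(1)[OF mod_H mod_H mod_HH mod_H corep_right_trilinear(1,3) linear_maps_ident])
  note \<Phi> = tlift_linear[OF mod_H mod_HH mod_HH bil] and \<Phi>_pure = tlift_tpure[OF mod_H mod_HH mod_HH bil]
  note cl = linear_maps_closed[OF comult_linear] and tcl = tpure_closed[OF mod_H mod_H]
  have bz: "(\<lambda>x y. tpure K H HH x (tpure K H H y z)) \<in> bilinear_maps K H H ?H3" if "z \<in> carrier H" for z
    by (rule bilinear_maps_comp[OF tp3 linear_maps_ident bilinear_mapsD(2)[OF tp that]])
  have lz: "(\<lambda>z. tpure K H HH x (tpure K H H y z)) \<in> linear_maps K H ?H3"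
    if "x \<in> carrier H" "y \<in> carrier H" for x y
    by (rule linear_maps_comp[OF bilinear_mapsD(1)[OF tp that(2)] bilinear_mapsD(1)[OF tp3 that(1)]])
  have bl: "(\<lambda>c' z. tlift K ?H3 (\<lambda>x y. tpure K H HH x (tpure K H H y z)) (comult H c')) \<in> bilinear_maps K H H ?H3"
    by (rule tlift_bilinear_param(2)[OF mod_H mod_H mod_H3 mod_H bz lz comult_linear])
  have br: "(\<lambda>x c'. tpure K H HH x (comult H c')) \<in> bilinear_maps K H H ?H3"
    by (rule bilinear_maps_comp[OF tp3 linear_maps_ident comult_linear])
  have "tlift K HH (\<lambda>c\<^sub>1 c\<^sub>2. ?\<Phi>' c\<^sub>1 (comult H c\<^sub>2)) (comult H c)
      = tlift K HH (\<lambda>c' c\<^sub>3. tlift K HH (\<lambda>c\<^sub>1 c\<^sub>2. tpure K H H (c\<^sub>1 \<otimes>\<^bsub>H\<^esub> S c\<^sub>2) c\<^sub>3) (comult H c')) (comult H c)"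
    if c: "c \<in> carrier H" for c
  proof -
    have "tlift K HH (\<lambda>c\<^sub>1 c\<^sub>2. ?\<Phi>' c\<^sub>1 (comult H c\<^sub>2)) (comult H c)
        = tlift K HH (\<lambda>x c'. ?\<Phi> (tpure K H HH x (comult H c'))) (comult H c)"
      by (rule tlift_cong[OF mod_H mod_H mod_HH linear_comp_bilinear[OF br \<Phi>] _ cl[OF c]])
        (simp add: \<Phi>_pure cl)
    also have "\<dots> = ?\<Phi> (tlift K ?H3 (\<lambda>x c'. tpure K H HH x (comult H c')) (comult H c))"
      by (rule linear_tlift[OF mod_H mod_H mod_H3 mod_HH br \<Phi> cl[OF c], symmetric])
    \<comment> \<open>Coassociativity enters here; the steps before and after it only move
      \<open>?\<Phi>\<close> through the sums.\<close>
    also have "\<dots> = ?\<Phi> (tlift K ?H3 (\<lambda>c' z. tlift K ?H3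
        (\<lambda>x y. tpure K H HH x (tpure K H H y z)) (comult H c')) (comult H c))"
      by (simp only: coassoc[OF c])
    also have "\<dots> = tlift K HH (\<lambda>c' z. ?\<Phi> (tlift K ?H3
        (\<lambda>x y. tpure K H HH x (tpure K H H y z)) (comult H c'))) (comult H c)"
      by (rule linear_tlift[OF mod_H mod_H mod_H3 mod_HH bl \<Phi> cl[OF c]])
    also have "\<dots> = tlift K HH (\<lambda>c' c\<^sub>3. tlift K HH
        (\<lambda>c\<^sub>1 c\<^sub>2. tpure K H H (c\<^sub>1 \<otimes>\<^bsub>H\<^esub> S c\<^sub>2) c\<^sub>3) (comult H c')) (comult H c)"
    proof (rule tlift_cong[OF mod_H mod_H mod_HH linear_comp_bilinear[OF bl \<Phi>] _ cl[OF c], symmetric])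
      fix c' z assume c': "c' \<in> carrier H" and z: "z \<in> carrier H"
      have "?\<Phi> (tlift K ?H3 (\<lambda>x y. tpure K H HH x (tpure K H H y z)) (comult H c'))
          = tlift K HH (\<lambda>x y. ?\<Phi> (tpure K H HH x (tpure K H H y z))) (comult H c')"
        by (rule linear_tlift[OF mod_H mod_H mod_H3 mod_HH bz[OF z] \<Phi> cl[OF c']])
      also have "\<dots> = tlift K HH (\<lambda>x y. tpure K H H (x \<otimes>\<^bsub>H\<^esub> S y) z) (comult H c')"
        by (rule tlift_cong[OF mod_H mod_H mod_HH corep_right_trilinear(2)[OF z] _ cl[OF c']])
          (simp add: \<Phi>_pure tcl z tlift_tpure[OF mod_H mod_H mod_HH corep_right_trilinear(1)])
      finally show "tlift K HH (\<lambda>c\<^sub>1 c\<^sub>2. tpure K H H (c\<^sub>1 \<otimes>\<^bsub>H\<^esub> S c\<^sub>2) z) (comult H c')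
          = ?\<Phi> (tlift K ?H3 (\<lambda>x y. tpure K H HH x (tpure K H H y z)) (comult H c'))" ..
    qed
    finally show ?thesis .
  qed
  then show ?thesis by (simp add: partial_corep_def linear_maps_ident)
qed

lemma partial_corep_along_surj_hom:
  assumes "module K C" "comult C \<in> linear_maps K C (tensor K C C)"
    and "module K D" "comult D \<in> linear_maps K D (tensor K D D)"
    and "g \<in> coalg_hom K C D" "carrier D = g ` carrier C"
    and "p \<in> linear_maps K D H" "\<And>c. c \<in> carrier C \<Longrightarrow> p (g c) = \<omega> c"
    and corep: "partial_corep K H S C \<omega>"
  shows "partial_corep K H S D p"
proof -
  have g: "g \<in> linear_maps K C D" using assms(5) by (simp add: coalg_hom_def)
  note gcl = linear_maps_closed[OF g] and pcl = linear_maps_closed[OF assms(7)]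
  note transfer = tlift_comult_coalg_hom[OF assms(1-3) mod_HH assms(5)]
  note comult_p = linear_maps_comp[OF assms(7) comult_linear]
  \<comment> \<open>\<open>?L1\<close>, \<open>?R1\<close> and \<open>?L2\<close>,
    \<open>?R2\<close> are the integrands of the two identities. The right-hand ones split an
    element of the coalgebra a second time and therefore take the coalgebra as a parameter.\<close>
  let ?L1 = "\<lambda>\<omega> c\<^sub>1 c\<^sub>2. tlift K HH (\<lambda>x y. tpure K H H x (y \<otimes>\<^bsub>H\<^esub> S (\<omega> c\<^sub>2))) (comult H (\<omega> c\<^sub>1))"
  let ?R1 = "\<lambda>C \<omega> c' c\<^sub>3. tlift K HH
    (\<lambda>c\<^sub>1 c\<^sub>2. tpure K H H (\<omega> c\<^sub>1) (\<omega> c\<^sub>2 \<otimes>\<^bsub>H\<^esub> S (\<omega> c\<^sub>3))) (comult C c')"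
  let ?L2 = "\<lambda>\<omega> c\<^sub>1 c\<^sub>2. tlift K HH (\<lambda>x y. tpure K H H (\<omega> c\<^sub>1 \<otimes>\<^bsub>H\<^esub> S x) y) (comult H (\<omega> c\<^sub>2))"
  let ?R2 = "\<lambda>C \<omega> c' c\<^sub>3. tlift K HH
    (\<lambda>c\<^sub>1 c\<^sub>2. tpure K H H (\<omega> c\<^sub>1 \<otimes>\<^bsub>H\<^esub> S (\<omega> c\<^sub>2)) (\<omega> c\<^sub>3)) (comult C c')"
  have bL1: "?L1 p \<in> bilinear_maps K D D HH"
    by (rule tlift_bilinear_param(2)[OF mod_H mod_H mod_HH assms(3) corep_left_trilinear(1)[OF pcl]
          linear_maps_comp[OF assms(7) corep_left_trilinear(2)] comult_p])
  have bL2: "?L2 p \<in> bilinear_maps K D D HH"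
    by (rule tlift_bilinear_param(1)[OF mod_H mod_H mod_HH assms(3) corep_right_trilinear(1)[OF pcl]
          linear_maps_comp[OF assms(7) corep_right_trilinear(3)] comult_p])
  have bR1': "(\<lambda>c\<^sub>1 c\<^sub>2. tpure K H H (p c\<^sub>1) (p c\<^sub>2 \<otimes>\<^bsub>H\<^esub> S (p z))) \<in> bilinear_maps K D D HH"
    if "z \<in> carrier D" for z
    by (rule bilinear_maps_comp[OF corep_left_trilinear(1)[OF pcl[OF that]] assms(7,7)])
  have bR2': "(\<lambda>c\<^sub>1 c\<^sub>2. tpure K H H (p c\<^sub>1 \<otimes>\<^bsub>H\<^esub> S (p c\<^sub>2)) (p z)) \<in> bilinear_maps K D D HH"
    if "z \<in> carrier D" for z
    by (rule bilinear_maps_comp[OF corep_right_trilinear(2)[OF pcl[OF that]] assms(7,7)])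
  have bR1: "?R1 D p \<in> bilinear_maps K D D HH"
    by (rule tlift_bilinear_param(2)[OF assms(3,3) mod_HH assms(3) bR1'
          linear_maps_comp[OF assms(7) corep_left_trilinear(2)[OF pcl pcl]] assms(4)])
  have bR2: "?R2 D p \<in> bilinear_maps K D D HH"
    by (rule tlift_bilinear_param(2)[OF assms(3,3) mod_HH assms(3) bR2'
          linear_maps_comp[OF assms(7) corep_right_trilinear(4)[OF pcl pcl]] assms(4)])
  \<comment> \<open>The inner sums are transferred before the outer ones, whose transfer asks for
    this agreement of integrands. On the left-hand sides the inner sum uses the comultiplication of
    \<open>H\<close>, and \<open>p (g c) = \<omega> c\<close> suffices.\<close>
  have R1: "?R1 C \<omega> x y = ?R1 D p (g x) (g y)" if "x \<in> carrier C" "y \<in> carrier C" for x y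
    using that by (intro transfer[OF bR1'[OF gcl], symmetric]) (simp_all add: assms(8))
  have R2: "?R2 C \<omega> x y = ?R2 D p (g x) (g y)" if "x \<in> carrier C" "y \<in> carrier C" for x y
    using that by (intro transfer[OF bR2'[OF gcl], symmetric]) (simp_all add: assms(8))
  have "counit H (p (g c)) = counit D (g c) \<and>
      tlift K HH (?L1 p) (comult D (g c)) = tlift K HH (?R1 D p) (comult D (g c)) \<and>
      tlift K HH (?L2 p) (comult D (g c)) = tlift K HH (?R2 D p) (comult D (g c))"
    if c: "c \<in> carrier C" for c
  proof -
    have "tlift K HH (?L1 p) (comult D (g c)) = tlift K HH (?L1 \<omega>) (comult C c)"
      by (rule transfer[OF bL1 _ c]) (simp add: assms(8))
    moreover have "tlift K HH (?R1 D p) (comult D (g c)) = tlift K HH (?R1 C \<omega>) (comult C c)"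
      by (rule transfer[OF bR1 R1 c])
    moreover have "tlift K HH (?L2 p) (comult D (g c)) = tlift K HH (?L2 \<omega>) (comult C c)"
      by (rule transfer[OF bL2 _ c]) (simp add: assms(8))
    moreover have "tlift K HH (?R2 D p) (comult D (g c)) = tlift K HH (?R2 C \<omega>) (comult C c)"
      by (rule transfer[OF bR2 R2 c])
    moreover have "counit D (g c) = counit C c" using assms(5) c by (simp add: coalg_hom_def)
    ultimately show ?thesis using corep c by (simp add: partial_corep_def assms(8))
  qed
  then show ?thesis
    using assms(6,7) by (simp add: partial_corep_def)
qed

section \<open>The universal property\<close>

context
  fixes Q :: "('k, 'q) coalgebra" and p :: "'q \<Rightarrow> 'h"
  assumes coalg_Q: "coalgebra K Q" and p_lin: "p \<in> linear_maps K Q H"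
begin

abbreviation (input) "par_subspace \<equiv> module_span K Q
  (\<Union>{X. subcoalgebra K X Q \<and> partial_corep K H S (sub_coalg K Q X) p})"

text \<open>Makes the facts on subcoalgebras applicable to \<open>par_coalgebra\<close>, whose
  comultiplication is again given by a \<open>THE\<close>.\<close>

lemma par_subcoalgebra: "subcoalgebra K par_subspace Q"
  by (rule subcoalgebra_span[OF coalgebra_facts(2,3)[OF coalg_Q]]) blast

lemmas par_module = sub_module[OF coalgebra_facts[OF coalg_Q] par_subcoalgebra]

lemma ex1_factors_par_coalgebra:
  fixes C :: "('k, 'c) coalgebra"
  assumes "cofree_coalgebra TYPE('c) K H Q p" "coalgebra K C" "partial_corep K H S C \<omega>"
  shows "\<exists>!f. factors K p C (par_coalgebra K H S Q p) \<omega> f"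
proof -
  note Q = coalgebra_facts[OF coalg_Q] and C = coalgebra_facts[OF assms(2)]
  have "\<omega> \<in> linear_maps K C H" using assms(3) by (simp add: partial_corep_def)
  then have ex1: "\<exists>!g. factors K p C Q \<omega> g"
    using assms(1,2) unfolding cofree_coalgebra_def by blast
  then obtain g where g: "factors K p C Q \<omega> g" by blast
  then have hom: "g \<in> coalg_hom K C Q" and pg: "\<And>c. c \<in> carrier C \<Longrightarrow> p (g c) = \<omega> c"
    by (auto simp: factors_def)
  let ?X = "g ` carrier C" let ?B = "sub_coalg K Q ?X"
  have X: "subcoalgebra K ?X Q" by (rule coalg_hom_image_subcoalgebra[OF C(2,3) Q(2) hom])
  note XQ = subcoalgebra_subset[OF Q X]
  have "partial_corep K H S ?B p"
  proof (rule partial_corep_along_surj_hom[where g = g, OF C(2,3)])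
    show "p (g c) = \<omega> c" if "c \<in> carrier C" for c by (rule pg[OF that])
    show "partial_corep K H S C \<omega>" by (rule assms(3))
    show "module K ?B" by (rule sub_module[OF Q X])
    show "comult ?B \<in> linear_maps K ?B (tensor K ?B ?B)" by (rule comult_sub_coalg_linear[OF Q X])
    show "g \<in> coalg_hom K C ?B" by (rule coalg_hom_sub_coalgI[OF Q X C(2,3) hom]) simp
    show "p \<in> linear_maps K ?B H"
      by (rule linear_maps_comp[OF sub_coalg_incl_linear[OF XQ] p_lin])
  qed simp
  then have "?X \<subseteq> par_subspace"
    using X module_span_superset[of "\<Union>{X. subcoalgebra K X Q \<and> partial_corep K H S (sub_coalg K Q X) p}" K Q]
    by blast
  \<comment> \<open>The same function \<open>g\<close> serves with the smaller codomain: neither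
    extensionality nor the equation \<open>p (g c) = \<omega> c\<close> refers to the
    codomain.\<close>
  then have "factors K p C (par_coalgebra K H S Q p) \<omega> g"
    using g coalg_hom_sub_coalgI[OF Q par_subcoalgebra C(2,3) hom]
    by (simp add: factors_def par_coalgebra_def)
  moreover have "f = g" if "factors K p C (par_coalgebra K H S Q p) \<omega> f" for f
  proof -
    have "factors K p C Q \<omega> f"
      using that coalg_hom_sub_coalgD[OF Q par_subcoalgebra C(2,3)]
      by (simp add: factors_def par_coalgebra_def)
    then show ?thesis using ex1 g by blast
  qed
  ultimately show ?thesis by blast
qed

lemma section_into_par_coalgebra:
  assumes "factors K p H (par_coalgebra K H S Q p) (\<lambda>h. h) \<iota>"
  shows "inj_on \<iota> (carrier H)"
    and "subcoalgebra K (\<iota> ` carrier H) (par_coalgebra K H S Q p)"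
    and "direct_summand K (\<iota> ` carrier H) (par_coalgebra K H S Q p)"
proof -
  let ?P = "par_coalgebra K H S Q p"
  have modP: "module K ?P" unfolding par_coalgebra_def by (rule par_module)
  interpret P: module K ?P by (rule modP)
  have hom: "\<iota> \<in> coalg_hom K H ?P" and p\<iota>: "\<And>h. h \<in> carrier H \<Longrightarrow> p (\<iota> h) = h"
    using assms by (auto simp: factors_def)
  then have lin: "\<iota> \<in> linear_maps K H ?P" by (simp add: coalg_hom_def)
  show "inj_on \<iota> (carrier H)" using p\<iota> by (rule inj_on_inverseI)
  show "subcoalgebra K (\<iota> ` carrier H) ?P"
    by (rule coalg_hom_image_subcoalgebra[OF mod_H comult_linear modP hom])
  have pP: "p \<in> linear_maps K ?P H"
    unfolding par_coalgebra_def
    by (rule linear_maps_comp[OF sub_coalg_incl_linear[OF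
            subcoalgebra_subset[OF coalgebra_facts[OF coalg_Q] par_subcoalgebra]] p_lin])
  let ?W = "{x \<in> carrier ?P. p x = \<zero>\<^bsub>H\<^esub>}"
  have img: "submodule (\<iota> ` carrier H) K ?P" by (rule submodule_image[OF lin mod_H modP])
  have W: "submodule ?W K ?P" by (rule submodule_kernel[OF pP modP mod_H])
  have \<iota>cl: "\<iota> h \<in> carrier ?P" if "h \<in> carrier H" for h by (rule linear_maps_closed[OF lin that])
  \<comment> \<open>\<open>x\<close> is split as \<open>\<iota> (p x)\<close> plus its difference
    from that; \<open>p\<close> kills the difference because \<open>p\<close> after
    \<open>\<iota>\<close> is the identity.\<close>
  have "x \<in> \<iota> ` carrier H <+>\<^bsub>?P\<^esub> ?W" if x: "x \<in> carrier ?P" for x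
  proof -
    have px: "p x \<in> carrier H" by (rule linear_maps_closed[OF pP x])
    have "p (x \<ominus>\<^bsub>?P\<^esub> \<iota> (p x)) = \<zero>\<^bsub>H\<^esub>"
      unfolding linear_maps_minus[OF pP modP mod_H x \<iota>cl[OF px]] p\<iota>[OF px]
      unfolding a_minus_def by (rule M.r_neg[OF px])
    then have "x \<ominus>\<^bsub>?P\<^esub> \<iota> (p x) \<in> ?W" using x px \<iota>cl by simp
    moreover have "x = \<iota> (p x) \<oplus>\<^bsub>?P\<^esub> (x \<ominus>\<^bsub>?P\<^esub> \<iota> (p x))"
      using x px \<iota>cl by (simp add: a_minus_def P.M.a_lcomm[of "\<iota> (p x)"] P.M.r_neg)
    ultimately show ?thesis using px unfolding set_add_def' by blast
  qed
  moreover have "\<iota> ` carrier H <+>\<^bsub>?P\<^esub> ?W \<subseteq> carrier ?P"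
    using \<iota>cl by (intro P.M.setadd_subset_G) auto
  \<comment> \<open>If \<open>\<iota> h\<close> is killed by \<open>p\<close>, then h = p(\<iota> h)
    = 0.\<close>
  moreover have "\<iota> ` carrier H \<inter> ?W = {\<zero>\<^bsub>?P\<^esub>}"
    using submodule_zero[OF img] submodule_zero[OF W] p\<iota> linear_maps_zero[OF lin mod_H modP] by auto
  ultimately show "direct_summand K (\<iota> ` carrier H) ?P"
    unfolding direct_summand_def using img W by blast
qed

end

end

text \<open>Cofreeness is relative to the carrier type of the test coalgebra and is therefore
  assumed twice: at \<open>'c\<close> for an arbitrary \<open>C\<close>, and at \<open>'h\<close>
  for the identity of \<open>H\<close>. Statement (ii) is made for every factorization
  \<open>\<iota>\<close> of the identity, of which the second conjunct provides exactly one.\<close>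

theorem lemma5p1:
  fixes K :: "('k, 'r) ring_scheme"
    and H :: "('k, 'h) coalgebra" and S :: "'h \<Rightarrow> 'h"
    and Q :: "('k, 'q) coalgebra" and p :: "'q \<Rightarrow> 'h"
  assumes "hopf_algebra K H S"
    and "cofree_coalgebra TYPE('c) K H Q p"
    and "cofree_coalgebra TYPE('h) K H Q p"
  shows
    "(\<forall>(C :: ('k, 'c) coalgebra) \<omega>. coalgebra K C \<and> partial_corep K H S C \<omega> \<longrightarrow>
        (\<exists>!f. factors K p C (par_coalgebra K H S Q p) \<omega> f)) \<and>
     (\<exists>!\<iota>. factors K p H (par_coalgebra K H S Q p) (\<lambda>h. h) \<iota>) \<and>
     (\<forall>\<iota>. factors K p H (par_coalgebra K H S Q p) (\<lambda>h. h) \<iota> \<longrightarrow>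
        inj_on \<iota> (carrier H) \<and>
        subcoalgebra K (\<iota> ` carrier H) (par_coalgebra K H S Q p) \<and>
        direct_summand K (\<iota> ` carrier H) (par_coalgebra K H S Q p))"
proof -
  have Q: "coalgebra K Q" "p \<in> linear_maps K Q H"
    using assms(2) by (simp_all add: cofree_coalgebra_def)
  have H: "coalgebra K H" using assms(1) by (simp add: hopf_algebra_def)
  show ?thesis
    using ex1_factors_par_coalgebra[OF assms(1) Q assms(2)]
      ex1_factors_par_coalgebra[OF assms(1) Q assms(3) H partial_corep_ident[OF assms(1)]]
      section_into_par_coalgebra[OF assms(1) Q]
    by blast
qed

end
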